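(* Let $X$ and $Y$ be complete separable differentiable manifolds equipped with Borel probability measures $\mu$ on $X$ and $\nu$ on $Y$. Let $c \in C^1(X \times Y)$ be a bounded cost function such that for each $y_1 \neq y_2$ in $Y$, the map $x \in X \mapsto c(x,y_1) - c(x,y_2)$ has no critical points, except at most one global minimum and at most one global maximum. Assume $d_x c(x,y)$ is locally bounded in $x$, uniformly in $y \in Y$. If $\mu$ is absolutely continuous (with respect to Lebesgue measure) in each coordinate chart on $X$, then the minimum $$\inf_{\gamma \in \Gamma(\mu,\nu)} \int_{X \times Y} c(x,y)\, d\gamma(x,y)$$ is attained by exactly one $\gamma \in \Gamma(\mu,\nu)$; moreover, this minimizer vanishes outside a numbered limb system having at most two limbs.
   Context: $\Gamma(\mu,\nu)$ denotes the set of Borel probability measures on $X \times Y$ whose marginals are $\mu$ on $X$ and $\nu$ on $Y$. A measure $\gamma$ vanishes outside $S \subset X\times Y$ if the complement of $S$ has zero $\gamma$-outer measure. For a map $f$ defined on $D$, $\mathrm{Graph}(f) = \{(x,f(x)) \mid x \in D\}$, $\mathrm{Dom} f = D$, $\mathrm{Ran} f$ its image; for $g: D \subset Y \to X$, $\mathrm{Antigraph}(g) = \{(g(y),y) \mid y \in D\} \subset X \times Y$. Numbered limb system: a relation $S \subset X \times Y$ is a numbered limb system if there are countable disjoint decompositions $X = \bigcup_{i=0}^\infty I_{2i+1}$ and $Y = \bigcup_{i=0}^\infty I_{2i}$ and maps $f_{2i}: \mathrm{Dom}(f_{2i}) \subset Y \to X$ and $f_{2i+1}: \mathrm{Dom}(f_{2i+1})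 \subset X \to Y$ such that $S = \bigcup_{i=1}^\infty \mathrm{Graph}(f_{2i-1}) \cup \mathrm{Antigraph}(f_{2i})$ and $\mathrm{Dom}(f_k) \cup \mathrm{Ran}(f_{k+1}) \subset I_k$ for every $k \ge 0$. The system has at most $N$ limbs if $\mathrm{Dom}(f_k) = \emptyset$ for all $k > N$. *)

theory Defs
  imports "HOL-Analysis.Analysis" "HOL-Probability.Probability"
begin

definition is_chart :: "('a::topological_space set \<times> ('a \<Rightarrow> 'e::euclidean_space) \<times> ('e \<Rightarrow> 'a)) \<Rightarrow> bool" where
  "is_chart C \<longleftrightarrow> (case C of (U, \<phi>, \<psi>) \<Rightarrow>
      open U \<and> open (\<phi> ` U) \<and> homeomorphism U (\<phi> ` U) \<phi> \<psi>)"

definition C1_on :: "'e::euclidean_space set \<Rightarrow> ('e \<Rightarrow> 'f::real_normed_vector) \<Rightarrow> bool" where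
  "C1_on S f \<longleftrightarrow> (\<exists>D :: 'e \<Rightarrow> ('e \<Rightarrow>\<^sub>L 'f).
      (\<forall>x\<in>S. (f has_derivative blinfun_apply (D x)) (at x)) \<and> continuous_on S D)"

definition C1_atlas :: "('a::topological_space set \<times> ('a \<Rightarrow> 'e::euclidean_space) \<times> ('e \<Rightarrow> 'a)) set \<Rightarrow> bool" where
  "C1_atlas A \<longleftrightarrow> (\<forall>C\<in>A. is_chart C) \<and> (\<Union>(U, _, _)\<in>A. U) = UNIV \<and>
     (\<forall>(U1, \<phi>1, \<psi>1)\<in>A. \<forall>(U2, \<phi>2, \<psi>2)\<in>A. C1_on (\<phi>1 ` (U1 \<inter> U2)) (\<phi>2 \<circ> \<psi>1))"

definition C1_prod :: "('a::topological_space set \<times> ('a \<Rightarrow> 'm::euclidean_space) \<times> ('m \<Rightarrow> 'a)) set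
    \<Rightarrow> ('b::topological_space set \<times> ('b \<Rightarrow> 'n::euclidean_space) \<times> ('n \<Rightarrow> 'b)) set
    \<Rightarrow> ('a \<times> 'b \<Rightarrow> real) \<Rightarrow> bool" where
  "C1_prod AX AY c \<longleftrightarrow> (\<forall>(U, \<phi>, \<psi>)\<in>AX. \<forall>(V, \<kappa>, \<theta>)\<in>AY.
      C1_on (\<phi> ` U \<times> \<kappa> ` V) (\<lambda>(p, q). c (\<psi> p, \<theta> q)))"

definition critical_point :: "('a::topological_space set \<times> ('a \<Rightarrow> 'e::euclidean_space) \<times> ('e \<Rightarrow> 'a)) set
    \<Rightarrow> ('a \<Rightarrow> real) \<Rightarrow> 'a \<Rightarrow> bool" where
  "critical_point A f x \<longleftrightarrow> (\<exists>(U, \<phi>, \<psi>)\<in>A. x \<in> U \<and> ((f \<circ> \<psi>) has_derivative (\<lambda>v. 0)) (at (\<phi> x)))"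

definition crit_only_extrema :: "('a::topological_space set \<times> ('a \<Rightarrow> 'e::euclidean_space) \<times> ('e \<Rightarrow> 'a)) set
    \<Rightarrow> ('a \<Rightarrow> real) \<Rightarrow> bool" where
  "crit_only_extrema A f \<longleftrightarrow>
     (\<forall>x. critical_point A f x \<longrightarrow> (\<forall>z. f x \<le> f z) \<or> (\<forall>z. f z \<le> f x)) \<and>
     (\<forall>x x'. critical_point A f x \<and> critical_point A f x' \<and> (\<forall>z. f x \<le> f z) \<and> (\<forall>z. f x' \<le> f z) \<longrightarrow> x = x') \<and>
     (\<forall>x x'. critical_point A f x \<and> critical_point A f x' \<and> (\<forall>z. f z \<le> f x) \<and> (\<forall>z. f z \<le> f x') \<longrightarrow> x = x')"

definition dx_locally_bounded :: "('a::topological_space set \<times> ('a \<Rightarrow> 'm::euclidean_space) \<times> ('m \<Rightarrow> 'a)) set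
    \<Rightarrow> ('a \<times> 'b \<Rightarrow> real) \<Rightarrow> bool" where
  "dx_locally_bounded AX c \<longleftrightarrow> (\<forall>x0. \<forall>(U, \<phi>, \<psi>)\<in>AX. x0 \<in> U \<longrightarrow>
     (\<exists>W B. open W \<and> x0 \<in> W \<and> W \<subseteq> U \<and>
        (\<forall>y. \<forall>x\<in>W. \<forall>D :: 'm \<Rightarrow>\<^sub>L real.
            ((\<lambda>p. c (\<psi> p, y)) has_derivative blinfun_apply D) (at (\<phi> x)) \<longrightarrow> norm D \<le> B)))"

definition abs_cont_in_charts :: "('a::topological_space set \<times> ('a \<Rightarrow> 'm::euclidean_space) \<times> ('m \<Rightarrow> 'a)) set
    \<Rightarrow> 'a measure \<Rightarrow> bool" where
  "abs_cont_in_charts A \<mu> \<longleftrightarrow> (\<forall>(U, \<phi>, \<psi>)\<in>A. \<forall>N\<in>null_sets lborel.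
      emeasure \<mu> (U \<inter> \<phi> -` N) = 0)"

definition borel_prob :: "'a::topological_space measure \<Rightarrow> bool" where
  "borel_prob \<mu> \<longleftrightarrow> sets \<mu> = sets borel \<and> prob_space \<mu>"

definition couplings :: "'a::topological_space measure \<Rightarrow> 'b::topological_space measure \<Rightarrow> ('a \<times> 'b) measure set" where
  "couplings \<mu> \<nu> = {\<gamma>. borel_prob \<gamma> \<and> distr \<gamma> borel fst = \<mu> \<and> distr \<gamma> borel snd = \<nu>}"

definition vanishes_outside :: "'c measure \<Rightarrow> 'c set \<Rightarrow> bool" where
  "vanishes_outside \<gamma> S \<longleftrightarrow> (\<exists>N\<in>sets \<gamma>. - S \<subseteq> N \<and> emeasure \<gamma> N = 0)"

definition Graph :: "'a set \<Rightarrow> ('a \<Rightarrow> 'b) \<Rightarrow> ('a \<times> 'b) set" where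
  "Graph D f = {(x, f x) | x. x \<in> D}"

definition Antigraph :: "'b set \<Rightarrow> ('b \<Rightarrow> 'a) \<Rightarrow> ('a \<times> 'b) set" where
  "Antigraph D g = {(g y, y) | y. y \<in> D}"

text \<open>Numbered limb system with at most N limbs.  Encoding: f_(2i) = g i with domain DY i
  (subset of Y), f_(2i+1) = h i with domain DX i (subset of X); I_(2i) = IY i, I_(2i+1) = IX i.\<close>

definition numbered_limb_system_le :: "nat \<Rightarrow> ('a \<times> 'b) set \<Rightarrow> bool" where
  "numbered_limb_system_le Nl S \<longleftrightarrow>
    (\<exists>(IX :: nat \<Rightarrow> 'a set) (IY :: nat \<Rightarrow> 'b set) (DX :: nat \<Rightarrow> 'a set) (h :: nat \<Rightarrow> 'a \<Rightarrow> 'b)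
        (DY :: nat \<Rightarrow> 'b set) (g :: nat \<Rightarrow> 'b \<Rightarrow> 'a).
       (\<Union>i. IX i) = UNIV \<and> disjoint_family IX \<and>
       (\<Union>i. IY i) = UNIV \<and> disjoint_family IY \<and>
       S = (\<Union>i. Graph (DX i) (h i)) \<union> (\<Union>i\<in>{1..}. Antigraph (DY i) (g i)) \<and>
       (\<forall>i. DY i \<union> h i ` DX i \<subseteq> IY i) \<and>
       (\<forall>i. DX i \<union> g (Suc i) ` DY (Suc i) \<subseteq> IX i) \<and>
       (\<forall>i. 2 * i > Nl \<longrightarrow> DY i = {}) \<and>
       (\<forall>i. 2 * i + 1 > Nl \<longrightarrow> DX i = {}))"

end

theory Submission
  imports Defs
begin

text \<open>A minimizer exists by tightness of the set of couplings. Exchanging the second coordinates of two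
  independent samples of a minimizer shows that its topological support \<open>S\<close> is pairwise monotone:
  \<open>c (x, y) + c (x', y') \<le> c (x, y') + c (x', y)\<close> on \<open>S\<close>. Outside a null set of \<open>x\<close>, two partners
  \<open>y\<^sub>1 \<noteq> y\<^sub>2\<close> of \<open>x\<close> satisfy \<open>d\<^sub>x c (x, y\<^sub>1) = d\<^sub>x c (x, y\<^sub>2)\<close>, so by the twist hypothesis \<open>x\<close> is the unique
  minimum or maximum of \<open>c (\<cdot>, y\<^sub>1) - c (\<cdot>, y\<^sub>2)\<close>. Monotonicity then forces one of \<open>y\<^sub>1\<close>, \<open>y\<^sub>2\<close> to have
  \<open>x\<close> as its only partner. Splitting \<open>Y\<close> into points with several partners and the rest thus splits
  \<open>S\<close> into a graph and an antigraph. The antigraph part of a coupling is determined by \<open>\<nu>\<close>, and the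
  graph part by what remains of \<open>\<mu>\<close>; applied to the support of the midpoint of two minimizers, this
  gives uniqueness.\<close>

section \<open>Weak limits of tight sequences\<close>

text \<open>Projections of Borel sets need not be Borel, and the two limbs are compared with the
  marginals through projections. This shapes the second half: the support is replaced by a countable
  union of compact sets of full measure, whose projections are again countable unions of compact
  sets. The null set of points \<open>x\<close> to be discarded must not depend on the pair of
  partners, of which there may be uncountably many; it is therefore obtained from countably many
  approximate slopes. The midpoint is needed for uniqueness because the limb property does not pass
  to unions: two minimizers with separate limb systems could not be compared, whereas the midpoint
  is again optimal, by linearity of the cost, and its support carries both.\<close>

lemma summable_ternary_digits:
  fixes a :: "nat \<Rightarrow> bool"
  shows "summable (\<lambda>n. of_bool (a n) * (1/3::real) ^ n)"
  by (rule summable_comparison_test'[where g = "\<lambda>n. (1/3::real) ^ n" and N = 0])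
     (auto simp: summable_geometric)

text \<open>If \<open>j\<close> is the first index where the digits differ, that digit contributes
  \<open>(1/3) ^ j\<close> and all later ones together at most half of it. In base 2 the tail could
  cancel the leading difference entirely; hence base 3 with digits 0 and 1.\<close>

lemma ternary_digits_gap:
  fixes a b :: "nat \<Rightarrow> bool"
  assumes "a i \<noteq> b i"
  shows "(1/3::real) ^ i / 2 \<le>
    \<bar>(\<Sum>n. of_bool (a n) * (1/3::real) ^ n) - (\<Sum>n. of_bool (b n) * (1/3) ^ n)\<bar>"
proof -
  define d where "d n = (of_bool (a n) - of_bool (b n)) * (1/3::real) ^ n" for n
  define j where "j = (LEAST n. a n \<noteq> b n)"
  have j: "a j \<noteq> b j" and ji: "j \<le> i" and below: "\<And>n. n < j \<Longrightarrow> a n = b n"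
    using LeastI[of "\<lambda>n. a n \<noteq> b n" i] Least_le[of "\<lambda>n. a n \<noteq> b n" i]
      not_less_Least[of _ "\<lambda>n. a n \<noteq> b n"] assms
    unfolding j_def by blast+
  have sd: "summable d"
    using summable_diff[OF summable_ternary_digits[of a] summable_ternary_digits[of b]]
    by (simp add: d_def[abs_def] left_diff_distrib)
  have eq: "(\<Sum>n. of_bool (a n) * (1/3::real) ^ n) - (\<Sum>n. of_bool (b n) * (1/3) ^ n) = suminf d"
    by (simp add: suminf_diff summable_ternary_digits d_def[abs_def] left_diff_distrib)
  have "suminf d = (\<Sum>n. d (n + Suc j)) + sum d {..<Suc j}"
    by (rule suminf_split_initial_segment[OF sd])
  also have "sum d {..<Suc j} = d j"
    using below by (simp add: d_def)
  finally have split: "suminf d = (\<Sum>n. d (n + Suc j)) + d j" .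
  have dj: "\<bar>d j\<bar> = (1/3) ^ j"
    using j by (auto simp: d_def)
  have gs: "(\<lambda>n. (1/3::real) ^ Suc j * (1/3) ^ n) sums ((1/3) ^ Suc j * (3/2))"
    using sums_mult[OF geometric_sums[of "1/3::real"], of "(1/3) ^ Suc j"] by simp
  have bd: "\<bar>d (n + Suc j)\<bar> \<le> (1/3::real) ^ Suc j * (1/3) ^ n" for n
    by (auto simp: d_def power_add abs_mult)
  have "norm (\<Sum>n. d (n + Suc j)) \<le> (\<Sum>n. (1/3::real) ^ Suc j * (1/3) ^ n)"
    by (rule norm_suminf_le) (use bd sums_summable[OF gs] in auto)
  also have "\<dots> = (1/3) ^ j / 2"
    using sums_unique[OF gs] by simp
  finally have "\<bar>\<Sum>n. d (n + Suc j)\<bar> \<le> (1/3) ^ j / 2" by simp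
  then have "(1/3) ^ j / 2 \<le> \<bar>suminf d\<bar>"
    using dj unfolding split by linarith
  moreover have "(1/3::real) ^ i \<le> (1/3) ^ j"
    using ji by (intro power_decreasing) auto
  ultimately show ?thesis
    unfolding eq by linarith
qed

text \<open>A base works: a member inside the ball of half the distance around \<open>x\<close> has
  its closure in the closed ball, which misses \<open>y\<close>. Excluding \<open>y\<close> from the
  closure, not only from the set, makes the separation stable under limits.\<close>

lemma countable_separating_open_sets:
  obtains B :: "nat \<Rightarrow> 'a::{metric_space, second_countable_topology} set"
  where "\<And>i. open (B i)" "\<And>x y. x \<noteq> y \<Longrightarrow> \<exists>i. x \<in> B i \<and> y \<notin> closure (B i)"
proof -
  obtain C :: "'a set set" where C: "countable C" "topological_basis C"
    using ex_countable_basis by blast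
  \<comment> \<open>The empty set ensures that the family to be enumerated is nonempty.\<close>
  define B where "B = from_nat_into (insert {} C)"
  have ran: "range B = insert {} C"
    unfolding B_def using C by (intro range_from_nat_into) auto
  have "open (B i)" for i
    using ran C(2) topological_basis_open by (metis insertE open_empty rangeI)
  moreover have "\<exists>i. x \<in> B i \<and> y \<notin> closure (B i)" if "x \<noteq> y" for x y
  proof -
    have "x \<in> ball x (dist x y / 2)" using that by simp
    then obtain b where b: "b \<in> C" "x \<in> b" "b \<subseteq> ball x (dist x y / 2)"
      using topological_basisE[OF C(2) open_ball] by metis
    then obtain i where i: "B i = b" using ran by (metis insertCI rangeE)
    have "closure b \<subseteq> cball x (dist x y / 2)"
      using b by (meson ball_subset_cball closed_cball closure_minimal order_trans)
    moreover have "y \<notin> cball x (dist x y / 2)" using that by simp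
    ultimately show ?thesis using b i by blast
  qed
  ultimately show thesis using that by blast
qed

text \<open>The first projection is a continuous injection of the compact graph into a Hausdorff
  space, so its inverse is continuous.\<close>

lemma compact_graph_imp_continuous_on:
  fixes R :: "('a::t2_space \<times> 'b::t2_space) set"
  assumes "compact R" and "\<And>z e. (z, e) \<in> R \<Longrightarrow> f z = e"
  shows "continuous_on (fst ` R) f"
proof -
  have "continuous_on (fst ` R) (\<lambda>z. (z, f z))"
    by (rule continuous_on_inv[where f = fst]) (use assms in \<open>auto intro: continuous_on_fst continuous_on_id\<close>)
  then have "continuous_on (fst ` R) (snd \<circ> (\<lambda>z. (z, f z)))"
    by (intro continuous_on_compose continuous_on_snd continuous_on_id)
  then show ?thesis by (simp add: o_def)
qed

text \<open>A code map \<open>H\<close> into the reals need not be continuous, but its inverse extends continuously to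
  the closure of the image of each compact set; Helly's selection theorem on the real line is
  therefore enough for the limit measure.\<close>

lemma real_code_with_continuous_decoding:
  fixes K :: "nat \<Rightarrow> 'a::{metric_space, second_countable_topology} set"
  assumes K: "\<And>j. compact (K j)"
  obtains H :: "'a \<Rightarrow> real" and C :: "nat \<Rightarrow> real set" and J
  where "H \<in> borel_measurable borel" "\<And>e. H e \<in> {0..2}"
    "\<And>j. compact (C j)" "\<And>j. continuous_on (C j) J" "\<And>j e. e \<in> K j \<Longrightarrow> H e \<in> C j \<and> J (H e) = e"
proof -
  obtain B :: "nat \<Rightarrow> 'a set" where B: "\<And>i. open (B i)"
    "\<And>x y. x \<noteq> y \<Longrightarrow> \<exists>i. x \<in> B i \<and> y \<notin> closure (B i)"
    using countable_separating_open_sets by blast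
  have [measurable]: "B i \<in> sets borel" for i using B(1) by simp
  define H where "H e = (\<Sum>i. of_bool (e \<in> B i) * (1/3::real) ^ i)" for e
  have meas: "H \<in> borel_measurable borel"
    unfolding H_def by measurable
  have H01: "H e \<in> {0..2}" for e
  proof -
    have "0 \<le> H e" unfolding H_def
      by (intro suminf_nonneg summable_ternary_digits) auto
    moreover have "H e \<le> (\<Sum>i. (1/3::real) ^ i)" unfolding H_def
      by (intro suminf_le summable_ternary_digits summable_geometric) auto
    ultimately show ?thesis by (simp add: suminf_geometric)
  qed
  \<comment> \<open>Adding the limit points makes the graph compact; what remains is that a code
    still determines its point.\<close>
  define R where "R j = closure ((\<lambda>e. (H e, e)) ` K j)" for j
  have Rsub: "R j \<subseteq> {0..2} \<times> K j" for j
    unfolding R_def using H01 K[of j]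
    by (intro closure_minimal closed_Times compact_imp_closed) auto
  have Rc: "compact (R j)" for j
  proof -
    have "compact (({0..2} \<times> K j) \<inter> R j)"
      unfolding R_def by (intro compact_Int_closed compact_Times compact_Icc K closed_closure)
    then show ?thesis using Rsub[of j] by (simp add: inf.absorb2)
  qed
  \<comment> \<open>Near \<open>e\<close> digit \<open>i\<close> is 1 and near \<open>e'\<close> it
    is 0, since \<open>B i\<close> and the complement of its closure are open. Allowing different
    \<open>j\<close> and \<open>k\<close> gives one decoding \<open>J\<close> for all compact
    sets.\<close>
  have uniq: "e = e'" if "(z, e) \<in> R j" "(z, e') \<in> R k" for z e e' j k
  proof (rule ccontr)
    assume "e \<noteq> e'"
    then obtain i where i: "e \<in> B i" "e' \<notin> closure (B i)" using B(2) by blast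
    \<comment> \<open>Two codes within a quarter of \<open>(1/3) ^ i\<close> of \<open>z\<close> are
      closer together than the half guaranteed by \<open>ternary_digits_gap\<close>.\<close>
    define U where "U = ball z ((1/3) ^ i / 4) \<times> B i"
    define V where "V = ball z ((1/3) ^ i / 4) \<times> (- closure (B i))"
    have "open U" "open V" "(z, e) \<in> U" "(z, e') \<in> V"
      unfolding U_def V_def using B(1) i by (auto intro: open_Times)
    then have "U \<inter> closure ((\<lambda>e. (H e, e)) ` K j) \<noteq> {}"
      "V \<inter> closure ((\<lambda>e. (H e, e)) ` K k) \<noteq> {}"
      using that unfolding R_def by auto
    then have "U \<inter> (\<lambda>e. (H e, e)) ` K j \<noteq> {}" "V \<inter> (\<lambda>e. (H e, e)) ` K k \<noteq> {}"
      by (simp_all only: open_Int_closure_eq_empty[OF \<open>open U\<close>]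
          open_Int_closure_eq_empty[OF \<open>open V\<close>] not_False_eq_True)
    then obtain p q where "p \<in> K j" "(H p, p) \<in> U" "q \<in> K k" "(H q, q) \<in> V"
      by blast
    then have "p \<in> B i" "q \<notin> B i" "dist z (H p) < (1/3) ^ i / 4" "dist z (H q) < (1/3) ^ i / 4"
      using closure_subset[of "B i"] unfolding U_def V_def by auto
    moreover from this have "\<bar>H p - H q\<bar> < (1/3) ^ i / 2"
      unfolding dist_real_def by linarith
    ultimately have "p \<in> B i" "q \<notin> B i" "\<bar>H p - H q\<bar> < (1/3) ^ i / 2" by auto
    then show False
      using ternary_digits_gap[of "\<lambda>n. p \<in> B n" i "\<lambda>n. q \<in> B n"] unfolding H_def by simp
  qed
  define J where "J z = (THE e. \<exists>j. (z, e) \<in> R j)" for z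
  have J: "J z = e" if "(z, e) \<in> R j" for z e j
    unfolding J_def using that uniq by blast
  show thesis
  proof (rule that[of H "\<lambda>j. fst ` R j" J])
    show "compact (fst ` R j)" for j
      by (intro compact_continuous_image Rc continuous_intros)
    show "continuous_on (fst ` R j) J" for j
      using Rc J by (rule compact_graph_imp_continuous_on)
    show "H e \<in> fst ` R j \<and> J (H e) = e" if "e \<in> K j" for e j
    proof -
      have "(H e, e) \<in> (\<lambda>e. (H e, e)) ` K j" using that by simp
      then have "(H e, e) \<in> R j" unfolding R_def by (rule subsetD[OF closure_subset])
      then show ?thesis using J[of "H e" e j] image_eqI[of "H e" fst "(H e, e)" "R j"] by simp
    qed
  qed (use meas H01 in auto)
qed

section \<open>Borel probability measures tested on closed sets and continuous functions\<close>

lemma borel_prob_space: "borel_prob M \<Longrightarrow> prob_space M"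
  and borel_prob_sets: "borel_prob M \<Longrightarrow> sets M = sets borel"
  by (auto simp: borel_prob_def)

lemma borel_prob_UNIV: "borel_prob M \<Longrightarrow> space M = UNIV"
  using sets_eq_imp_space_eq[of M borel] by (simp add: borel_prob_def)

lemma (in prob_space) integral_diff_le_measure_agree:
  fixes u v :: "'a \<Rightarrow> real"
  assumes [measurable]: "u \<in> borel_measurable M" "v \<in> borel_measurable M" "S \<in> sets M"
    and u: "\<And>x. \<bar>u x\<bar> \<le> B" and v: "\<And>x. \<bar>v x\<bar> \<le> B"
    and eq: "\<And>x. x \<in> S \<Longrightarrow> u x = v x" and S: "1 - e \<le> prob S"
  shows "\<bar>integral\<^sup>L M u - integral\<^sup>L M v\<bar> \<le> 2 * B * e"
proof -
  have B: "0 \<le> B" using u[of undefined] by linarith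
  have iu: "integrable M u" "integrable M v"
    using u v by (auto intro!: integrable_const_bound[where B = B])
  have "\<bar>integral\<^sup>L M u - integral\<^sup>L M v\<bar> = \<bar>\<integral>x. u x - v x \<partial>M\<bar>"
    using iu by simp
  also have "\<dots> \<le> (\<integral>x. \<bar>u x - v x\<bar> \<partial>M)"
    by (rule integral_abs_bound)
  also have "\<dots> \<le> (\<integral>x. 2 * B * indicator (space M - S) x \<partial>M)"
  proof (rule integral_mono)
    show "integrable M (\<lambda>x. \<bar>u x - v x\<bar>)" using iu by simp
    show "integrable M (\<lambda>x. 2 * B * indicator (space M - S) x)"
      by (intro integrable_mult_right integrable_real_indicator) (auto simp: less_top[symmetric])
    show "\<bar>u x - v x\<bar> \<le> 2 * B * indicator (space M - S) x" if "x \<in> space M" for x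
      using u[of x] v[of x] eq[of x] that by (auto split: split_indicator)
  qed
  also have "\<dots> = 2 * B * prob (space M - S)"
    by simp
  also have "\<dots> \<le> 2 * B * e"
    using B S prob_compl[of S] by (intro mult_left_mono) auto
  finally show ?thesis .
qed

lemma infdist_cutoff_tendsto_indicator:
  fixes C :: "'a::metric_space set"
  assumes C: "closed C" "C \<noteq> {}"
  shows "(\<lambda>k. max 0 (1 - real k * infdist z C)) \<longlonglongrightarrow> indicator C z"
proof (cases "z \<in> C")
  case True
  then show ?thesis by simp
next
  case False
  then have pos: "0 < infdist z C"
    using C infdist_pos_not_in_closed by blast
  obtain N :: nat where N: "1 / infdist z C < real N"
    using reals_Archimedean2 by blast
  have "max 0 (1 - real k * infdist z C) = 0" if "k \<ge> N" for k
  proof -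
    have "1 \<le> real N * infdist z C"
      using N pos by (simp add: field_simps)
    also have "\<dots> \<le> real k * infdist z C"
      using that pos by (intro mult_right_mono) auto
    finally show ?thesis by simp
  qed
  then have "\<forall>\<^sub>F k in sequentially. max 0 (1 - real k * infdist z C) = 0"
    using eventually_sequentially by blast
  then show ?thesis using False by (simp add: tendsto_eventually)
qed

lemma integral_infdist_cutoff_tendsto:
  fixes M :: "'a::metric_space measure"
  assumes "prob_space M" and sets[measurable_cong]: "sets M = sets borel"
    and C: "closed C" "C \<noteq> {}"
  shows "(\<lambda>k. \<integral>z. max 0 (1 - real k * infdist z C) \<partial>M) \<longlonglongrightarrow> measure M C"
proof -
  interpret prob_space M by fact
  have Cb: "C \<in> events" using C sets by simp
  have [measurable]: "(\<lambda>z. infdist z C) \<in> borel_measurable borel"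
    by (intro borel_measurable_continuous_onI continuous_intros)
  have "(\<lambda>k. \<integral>z. max 0 (1 - real k * infdist z C) \<partial>M) \<longlonglongrightarrow> (\<integral>z. indicator C z \<partial>M)"
    by (rule integral_dominated_convergence[where w = "\<lambda>_. 1"])
       (use Cb infdist_cutoff_tendsto_indicator[OF C]
        in \<open>auto simp: sets intro!: AE_I2 mult_nonneg_nonneg infdist_nonneg\<close>)
  then show ?thesis using sets.Int_space_eq2[OF Cb] by simp
qed

text \<open>The closed-set half of the portmanteau theorem. Each cutoff \<open>g k\<close> is
  continuous and dominates the indicator of \<open>C\<close>, so the lower bound passes to the limit
  measure for fixed \<open>k\<close>; then \<open>k\<close> tends to infinity.\<close>

lemma real_distribution_closed_limit:
  fixes m :: "nat \<Rightarrow> real measure"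
  assumes m: "\<And>n. real_distribution (m n)" and M: "real_distribution M"
    and conv: "weak_conv_m m M" and C: "closed C" and le: "\<And>n. a \<le> measure (m n) C"
  shows "a \<le> measure M C"
proof (cases "C = {}")
  case True
  then show ?thesis using le[of 0] by simp
next
  case False
  interpret M: real_distribution M by fact
  have [measurable]: "C \<in> sets borel" using C by simp
  define g where "g k z = max 0 (1 - real k * infdist z C)" for k z
  have cg: "continuous_on UNIV (g k)" for k
    unfolding g_def by (intro continuous_intros)
  have [measurable]: "g k \<in> borel_measurable borel" for k
    using cg by (rule borel_measurable_continuous_onI)
  have g01: "0 \<le> g k z" "g k z \<le> 1" for k z
    unfolding g_def using infdist_nonneg[of z C] by auto
  have g1: "z \<in> C \<Longrightarrow> g k z = 1" for k z
    unfolding g_def by simp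
  have ge: "a \<le> integral\<^sup>L M (g k)" for k
  proof (rule LIMSEQ_le_const)
    show "(\<lambda>n. integral\<^sup>L (m n) (g k)) \<longlonglongrightarrow> integral\<^sup>L M (g k)"
    proof (rule weak_conv_imp_integral_bdd_continuous_conv[OF m M conv])
      show "isCont (g k) x" for x
        using cg by (simp add: continuous_on_eq_continuous_at)
      show "norm (g k x) \<le> 1" for x using g01 by simp
    qed
    show "\<exists>N. \<forall>n\<ge>N. a \<le> integral\<^sup>L (m n) (g k)"
    proof (intro exI allI impI)
      fix n :: nat
      interpret mn: real_distribution "m n" by fact
      have "a \<le> integral\<^sup>L (m n) (indicator C)" using le[of n] by simp
      also have "\<dots> \<le> integral\<^sup>L (m n) (g k)"
      proof (rule integral_mono)
        show "integrable (m n) (indicator C :: real \<Rightarrow> real)"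
          by (intro integrable_real_indicator) (auto simp: less_top[symmetric])
        show "integrable (m n) (g k)"
          using g01 by (intro mn.integrable_const_bound[where B = 1]) auto
        show "indicator C z \<le> g k z" for z
          using g01 g1 by (auto split: split_indicator)
      qed
      finally show "a \<le> integral\<^sup>L (m n) (g k)" .
    qed
  qed
  have "(\<lambda>k. integral\<^sup>L M (g k)) \<longlonglongrightarrow> measure M C"
    unfolding g_def by (rule integral_infdist_cutoff_tendsto) (use C False M.prob_space_axioms in auto)
  then show ?thesis
    by (rule LIMSEQ_le_const) (use ge in auto)
qed

lemma borel_prob_eqI_closed:
  fixes M N :: "'a::topological_space measure"
  assumes "borel_prob M" "borel_prob N"
    and "\<And>C. closed C \<Longrightarrow> emeasure M C = emeasure N C"
  shows "M = N"
proof (rule measure_eqI_generator_eq[where E = "Collect closed" and \<Omega> = UNIV and A = "\<lambda>_. UNIV"])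
  have "sets (borel :: 'a measure) = sigma_sets UNIV (Collect closed)"
    unfolding borel_eq_closed by (intro sets_measure_of) simp
  then show "sets M = sigma_sets UNIV (Collect closed)" "sets N = sigma_sets UNIV (Collect closed)"
    using assms borel_prob_sets by blast+
  show "emeasure M UNIV \<noteq> \<infinity>"
    using assms(1) borel_prob_space prob_space.emeasure_le_1 by (metis ennreal_one_neq_top infinity_ennreal_def neq_top_trans)
qed (use assms in \<open>auto simp: Int_stable_def\<close>)

text \<open>Continuous cutoffs converge to the indicators of closed sets, and these form an
  intersection-stable generator.\<close>

lemma borel_prob_eqI_integral:
  fixes M N :: "'a::metric_space measure"
  assumes M: "borel_prob M" and N: "borel_prob N"
    and eq: "\<And>f :: 'a \<Rightarrow> real. continuous_on UNIV f \<Longrightarrow> (\<And>x. \<bar>f x\<bar> \<le> 1) \<Longrightarrow>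
      integral\<^sup>L M f = integral\<^sup>L N f"
  shows "M = N"
proof (rule borel_prob_eqI_closed[OF M N])
  fix C :: "'a set" assume C: "closed C"
  interpret M: prob_space M using M by (rule borel_prob_space)
  interpret N: prob_space N using N by (rule borel_prob_space)
  show "emeasure M C = emeasure N C"
  proof (cases "C = {}")
    case False
    let ?g = "\<lambda>k z. max 0 (1 - real k * infdist z C)"
    have "integral\<^sup>L M (?g k) = integral\<^sup>L N (?g k)" for k
      by (intro eq continuous_intros) (auto simp: infdist_nonneg abs_if)
    then have "M.prob C = N.prob C"
      using integral_infdist_cutoff_tendsto[OF M.prob_space_axioms borel_prob_sets[OF M] C False]
        integral_infdist_cutoff_tendsto[OF N.prob_space_axioms borel_prob_sets[OF N] C False]
      by (simp add: LIMSEQ_unique)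
    then show ?thesis by (simp add: M.emeasure_eq_measure N.emeasure_eq_measure)
  qed simp
qed

text \<open>Prokhorov's theorem for sequences. Helly's theorem gives a limit \<open>M\<close> of the
  coded measures, and \<open>J\<close> carries it back. For a test function \<open>f\<close>, the
  function \<open>f \<circ> J\<close> on \<open>C j\<close> extends by Tietze to a bounded
  continuous \<open>g\<close> on the line; \<open>g \<circ> H\<close> agrees with \<open>f\<close>
  on \<open>K j\<close>, so only the small mass outside the compact sets produces an error.\<close>

theorem tight_sequence_weak_limit:
  fixes \<gamma> :: "nat \<Rightarrow> 'a::{metric_space, second_countable_topology} measure"
  assumes prob: "\<And>n. borel_prob (\<gamma> n)" and K: "\<And>j. compact (K j)"
    and tight: "\<And>n j. 1 - 1 / real (Suc j) \<le> measure (\<gamma> n) (K j)"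
  obtains s G where "strict_mono (s :: nat \<Rightarrow> nat)" "borel_prob G"
    "\<And>(f :: 'a \<Rightarrow> real) B. continuous_on UNIV f \<Longrightarrow> (\<And>x. \<bar>f x\<bar> \<le> B) \<Longrightarrow>
      (\<lambda>n. integral\<^sup>L (\<gamma> (s n)) f) \<longlonglongrightarrow> integral\<^sup>L G f"
proof -
  obtain H :: "'a \<Rightarrow> real" and C J where H[measurable]: "H \<in> borel_measurable borel"
    and H02: "\<And>e. H e \<in> {0..2}" and C: "\<And>j. compact (C j)" "\<And>j. continuous_on (C j) J"
    and HJ: "\<And>j e. e \<in> K j \<Longrightarrow> H e \<in> C j \<and> J (H e) = e"
    using real_code_with_continuous_decoding[where K = K, OF K] by blast
  have Cb[measurable]: "C j \<in> sets borel" and Kb[measurable]: "K j \<in> sets borel" for j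
    using C K by (auto intro: borel_compact)
  interpret \<gamma>: prob_space "\<gamma> n" for n using prob by (rule borel_prob_space)
  have sg[measurable_cong]: "sets (\<gamma> n) = sets borel" for n using prob by (rule borel_prob_sets)
  have spg: "space (\<gamma> n) = UNIV" for n using sets_eq_imp_space_eq[OF sg] by simp
  define m where "m n = distr (\<gamma> n) borel H" for n
  have rd: "real_distribution (m n)" for n
    unfolding m_def by (intro \<gamma>.real_distribution_distr) measurable
  have "tight m"
    unfolding tight_def
  proof (intro conjI allI impI rd)
    fix \<epsilon> :: real assume "\<epsilon> > 0"
    \<comment> \<open>\<open>tight\<close> is phrased with half-open intervals, so the left end must
      lie strictly below 0.\<close>
    have "H e \<in> {-1<..2}" for e using H02[of e] by simp
    then have "H -` {-1<..2} = UNIV" by blast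
    then have "measure (m n) {-1<..2} = 1" for n
      unfolding m_def using \<gamma>.prob_space by (subst measure_distr) (auto simp: spg)
    then show "\<exists>a b. a < b \<and> (\<forall>n. 1 - \<epsilon> < measure (m n) {a<..b})"
      using \<open>\<epsilon> > 0\<close> by (intro exI[of _ "-1"] exI[of _ 2]) auto
  qed
  then obtain r M where r: "strict_mono (r :: nat \<Rightarrow> nat)" and M: "real_distribution M"
    and conv: "weak_conv_m (m \<circ> id \<circ> r) M"
    using tight_imp_convergent_subsubsequence[of m id] by (auto simp: strict_mono_def)
  interpret M: real_distribution M by fact
  have conv: "weak_conv_m (\<lambda>n. m (r n)) M" using conv by (simp add: o_def)
  have mC: "1 - 1 / real (Suc j) \<le> measure M (C j)" for j
  proof (rule real_distribution_closed_limit[OF _ M conv])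
    show "1 - 1 / real (Suc j) \<le> measure (m (r n)) (C j)" for n
    proof -
      have "measure (\<gamma> (r n)) (K j) \<le> measure (\<gamma> (r n)) (H -` C j \<inter> space (\<gamma> (r n)))"
        using HJ measurable_sets_borel[OF H Cb[of j]]
        by (intro \<gamma>.finite_measure_mono) (auto simp: spg sg)
      also have "\<dots> = measure (m (r n)) (C j)"
        unfolding m_def by (subst measure_distr) auto
      finally show ?thesis using tight[of j "r n"] by linarith
    qed
  qed (use rd C compact_imp_closed in auto)
  \<comment> \<open>By \<open>mC\<close> the union of the \<open>C j\<close> has full
    \<open>M\<close>-measure, so the value chosen elsewhere does not affect \<open>G\<close>; it
    only makes the decoding a Borel map on the whole line.\<close>
  define J' where "J' z = (if z \<in> (\<Union>j. C j) then J z else undefined)" for z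
  have J'[measurable]: "J' \<in> borel \<rightarrow>\<^sub>M borel"
  proof (rule measurable_piecewise_restrict[where C = "insert (- (\<Union>j. C j)) (range C)"])
    fix \<Omega> assume "\<Omega> \<in> insert (- (\<Union>j. C j)) (range C)"
    then consider "\<Omega> = - (\<Union>j. C j)" | j where "\<Omega> = C j" by auto
    then show "J' \<in> restrict_space borel \<Omega> \<rightarrow>\<^sub>M borel"
    proof cases
      case 1
      have "J' \<in> restrict_space borel \<Omega> \<rightarrow>\<^sub>M borel \<longleftrightarrow>
        (\<lambda>_. undefined) \<in> restrict_space borel \<Omega> \<rightarrow>\<^sub>M (borel :: 'a measure)"
        using 1 by (intro measurable_cong) (auto simp: J'_def space_restrict_space)
      then show ?thesis by simp
    next
      case 2
      have "J' \<in> restrict_space borel \<Omega> \<rightarrow>\<^sub>M borel \<longleftrightarrow> J \<in> restrict_space borel \<Omega> \<rightarrow>\<^sub>M borel"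
        using 2 by (intro measurable_cong) (auto simp: J'_def space_restrict_space)
      then show ?thesis
        using 2 C(2) borel_measurable_continuous_on_restrict by metis
    qed
  qed auto
  have J'C: "J' z = J z" if "z \<in> C j" for z j using that by (auto simp: J'_def)
  define G where "G = distr M borel J'"
  show thesis
  proof (rule that[of r G])
    show "borel_prob G"
      unfolding borel_prob_def G_def by (auto intro!: M.prob_space_distr)
    fix f :: "'a \<Rightarrow> real" and B
    assume f: "continuous_on UNIV f" and fB: "\<And>x. \<bar>f x\<bar> \<le> B"
    have [measurable]: "f \<in> borel_measurable borel"
      using f by (rule borel_measurable_continuous_onI)
    have B: "0 \<le> B" using fB[of undefined] by linarith
    have Gf: "integral\<^sup>L G f = (\<integral>z. f (J' z) \<partial>M)"
      unfolding G_def by (subst integral_distr) auto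
    show "(\<lambda>n. integral\<^sup>L (\<gamma> (r n)) f) \<longlonglongrightarrow> integral\<^sup>L G f"
    proof (rule LIMSEQ_I)
      fix \<epsilon> :: real assume "\<epsilon> > 0"
      \<comment> \<open>The error is split into three: one third of \<open>\<epsilon>\<close> for
        replacing \<open>f\<close> before the limit, one for replacing it after, and one for the
        convergence of the integrals of \<open>g\<close>.\<close>
      obtain j :: nat where "6 * B / \<epsilon> < real j" using reals_Archimedean2 by blast
      then have "6 * B < \<epsilon> * real (Suc j)" using \<open>\<epsilon> > 0\<close> by (simp add: field_simps)
      then have j: "2 * B * (1 / real (Suc j)) < \<epsilon> / 3" by (simp add: field_simps)
      have "continuous_on (C j) (\<lambda>z. f (J z))"
        by (rule continuous_on_compose2[OF f C(2)]) auto
      then obtain g where g: "continuous_on UNIV g" "\<And>z. z \<in> C j \<Longrightarrow> g z = f (J z)"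
        "\<And>z. norm (g z) \<le> B"
        by (rule Tietze[where U = UNIV and B = B])
           (use fB B compact_imp_closed[OF C(1)[of j]] in auto)
      have [measurable]: "g \<in> borel_measurable borel"
        using g(1) by (rule borel_measurable_continuous_onI)
      have gm: "integral\<^sup>L (m n) g = (\<integral>e. g (H e) \<partial>\<gamma> n)" for n
        unfolding m_def by (subst integral_distr) auto
      have "(\<lambda>n. integral\<^sup>L (m (r n)) g) \<longlonglongrightarrow> integral\<^sup>L M g"
      proof (rule weak_conv_imp_integral_bdd_continuous_conv[OF _ M conv])
        show "isCont g x" for x
          using g by (simp add: continuous_on_eq_continuous_at)
      qed (use rd g in auto)
      then obtain N where N: "\<And>n. n \<ge> N \<Longrightarrow> norm (integral\<^sup>L (m (r n)) g - integral\<^sup>L M g) < \<epsilon> / 3"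
        using LIMSEQ_D[of _ _ "\<epsilon> / 3"] \<open>\<epsilon> > 0\<close> by (metis zero_less_divide_iff zero_less_numeral)
      have d1: "\<bar>integral\<^sup>L (m n) g - integral\<^sup>L (\<gamma> n) f\<bar> \<le> 2 * B * (1 / real (Suc j))" for n
        unfolding gm by (rule \<gamma>.integral_diff_le_measure_agree[where S = "K j"])
          (use g fB HJ[of _ j] tight[of j] in auto)
      have d2: "\<bar>integral\<^sup>L M g - integral\<^sup>L G f\<bar> \<le> 2 * B * (1 / real (Suc j))"
        unfolding Gf by (rule M.integral_diff_le_measure_agree[where S = "C j"])
          (use g fB mC[of j] J'C[of _ j] in auto)
      show "\<exists>N. \<forall>n\<ge>N. norm (integral\<^sup>L (\<gamma> (r n)) f - integral\<^sup>L G f) < \<epsilon>"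
      proof (intro exI[of _ N] allI impI)
        fix n assume "n \<ge> N"
        then show "norm (integral\<^sup>L (\<gamma> (r n)) f - integral\<^sup>L G f) < \<epsilon>"
          using N[of n] d1[of "r n"] d2 j unfolding real_norm_def by linarith
      qed
    qed
  qed (rule r)
qed

section \<open>Existence of an optimal coupling\<close>

lemma borel_prob_inner_compact:
  fixes M :: "'a::{complete_space, second_countable_topology} measure"
  assumes M: "borel_prob M" and A: "A \<in> sets borel" and e: "0 < e"
  obtains K where "compact K" "K \<subseteq> A" "measure M A - e < measure M K"
proof -
  interpret prob_space M using M by (rule borel_prob_space)
  have sets: "sets M = sets borel" using M by (rule borel_prob_sets)
  show thesis
  proof (cases "measure M A - e < 0")
    case True
    then show ?thesis using that[of "{}"] by auto
  next
    case False
    have "ennreal (measure M A - e) < emeasure M A"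
      using False e by (simp add: emeasure_eq_measure ennreal_less_iff)
    also have "emeasure M A = (SUP K\<in>{K. K \<subseteq> A \<and> compact K}. emeasure M K)"
      using A by (intro inner_regular) (auto simp: sets)
    finally obtain K where "K \<subseteq> A" "compact K" "ennreal (measure M A - e) < emeasure M K"
      by (auto simp: less_SUP_iff)
    then show ?thesis
      using that[of K] False by (simp add: emeasure_eq_measure ennreal_less_iff)
  qed
qed

section \<open>Couplings and their marginals\<close>

lemma borel_measurable_fst_snd:
  "fst \<in> borel_measurable borel" "snd \<in> borel_measurable borel"
  by (intro borel_measurable_continuous_onI continuous_on_fst continuous_on_snd continuous_on_id)+

lemma couplings_borel_prob: "\<gamma> \<in> couplings \<mu> \<nu> \<Longrightarrow> borel_prob \<gamma>"
  by (simp add: couplings_def)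

lemma couplings_emeasure_fst:
  assumes "\<gamma> \<in> couplings \<mu> \<nu>" "A \<in> sets borel"
  shows "emeasure \<gamma> (fst -` A) = emeasure \<mu> A"
proof -
  have s: "sets \<gamma> = sets borel" using assms couplings_borel_prob borel_prob_sets by blast
  moreover have "space \<gamma> = UNIV"
    using assms couplings_borel_prob borel_prob_UNIV by blast
  moreover have "fst \<in> \<gamma> \<rightarrow>\<^sub>M borel"
    using borel_measurable_fst_snd(1) by (simp add: measurable_cong_sets[OF s refl])
  moreover have "distr \<gamma> borel fst = \<mu>" using assms by (simp add: couplings_def)
  ultimately show ?thesis using assms(2) emeasure_distr[of fst \<gamma> borel A] by simp
qed

lemma couplings_emeasure_snd:
  assumes "\<gamma> \<in> couplings \<mu> \<nu>" "B \<in> sets borel"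
  shows "emeasure \<gamma> (snd -` B) = emeasure \<nu> B"
proof -
  have s: "sets \<gamma> = sets borel" using assms couplings_borel_prob borel_prob_sets by blast
  moreover have "space \<gamma> = UNIV"
    using assms couplings_borel_prob borel_prob_UNIV by blast
  moreover have "snd \<in> \<gamma> \<rightarrow>\<^sub>M borel"
    using borel_measurable_fst_snd(2) by (simp add: measurable_cong_sets[OF s refl])
  moreover have "distr \<gamma> borel snd = \<nu>" using assms by (simp add: couplings_def)
  ultimately show ?thesis using assms(2) emeasure_distr[of snd \<gamma> borel B] by simp
qed

lemma couplingsI:
  assumes \<gamma>: "borel_prob \<gamma>" and \<mu>: "borel_prob \<mu>" and \<nu>: "borel_prob \<nu>"
    and fst: "\<And>A. A \<in> sets borel \<Longrightarrow> emeasure \<gamma> (fst -` A) = emeasure \<mu> A"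
    and snd: "\<And>B. B \<in> sets borel \<Longrightarrow> emeasure \<gamma> (snd -` B) = emeasure \<nu> B"
  shows "\<gamma> \<in> couplings \<mu> \<nu>"
proof -
  have s: "sets \<gamma> = sets borel" using \<gamma> by (rule borel_prob_sets)
  have sp: "space \<gamma> = UNIV" using \<gamma> by (rule borel_prob_UNIV)
  have m: "fst \<in> \<gamma> \<rightarrow>\<^sub>M borel" "snd \<in> \<gamma> \<rightarrow>\<^sub>M borel"
    using borel_measurable_fst_snd by (simp_all add: measurable_cong_sets[OF s refl])
  have "distr \<gamma> borel fst = \<mu>"
    by (rule measure_eqI) (simp_all add: borel_prob_sets[OF \<mu>] emeasure_distr[OF m(1)] sp fst)
  moreover have "distr \<gamma> borel snd = \<nu>"
    by (rule measure_eqI) (simp_all add: borel_prob_sets[OF \<nu>] emeasure_distr[OF m(2)] sp snd)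
  ultimately show ?thesis using \<gamma> by (simp add: couplings_def)
qed

text \<open>The independent coupling shows that the infimum of the cost is taken over a nonempty
  set.\<close>

lemma pair_measure_in_couplings:
  fixes \<mu> :: "'a::second_countable_topology measure" and \<nu> :: "'b::second_countable_topology measure"
  assumes \<mu>: "borel_prob \<mu>" and \<nu>: "borel_prob \<nu>"
  shows "\<mu> \<Otimes>\<^sub>M \<nu> \<in> couplings \<mu> \<nu>"
proof -
  interpret \<mu>: prob_space \<mu> using \<mu> by (rule borel_prob_space)
  interpret \<nu>: prob_space \<nu> using \<nu> by (rule borel_prob_space)
  interpret pair_prob_space \<mu> \<nu> ..
  note s = borel_prob_sets[OF \<mu>] borel_prob_sets[OF \<nu>]
  note sp = borel_prob_UNIV[OF \<mu>] borel_prob_UNIV[OF \<nu>]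
  have "sets (\<mu> \<Otimes>\<^sub>M \<nu>) = sets borel"
    using sets_pair_measure_cong[OF s] unfolding borel_prod .
  then have "borel_prob (\<mu> \<Otimes>\<^sub>M \<nu>)"
    unfolding borel_prob_def using prob_space_axioms by simp
  moreover have "fst -` A = A \<times> (UNIV :: 'b set)" "snd -` B = (UNIV :: 'a set) \<times> B"
    for A :: "'a set" and B :: "'b set"
    by auto
  ultimately show ?thesis
    using \<mu>.emeasure_space_1 \<nu>.emeasure_space_1 s sp sets.top[of \<mu>] sets.top[of \<nu>]
    by (intro couplingsI \<mu> \<nu>) (simp_all add: \<nu>.emeasure_pair_measure_Times)
qed

text \<open>The direct method. Since \<open>c\<close> is bounded and continuous, the cost converges
  along the subsequence; the marginals of the limit are identified by test functions of one
  coordinate, whose integrals are constant along the sequence.\<close>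

theorem optimal_coupling_exists:
  fixes \<mu> :: "'a::polish_space measure" and \<nu> :: "'b::polish_space measure"
    and c :: "'a \<times> 'b \<Rightarrow> real"
  assumes \<mu>: "borel_prob \<mu>" and \<nu>: "borel_prob \<nu>"
    and c: "continuous_on UNIV c" and cB: "\<And>z. \<bar>c z\<bar> \<le> B"
  shows "\<exists>\<gamma>\<in>couplings \<mu> \<nu>. \<forall>\<gamma>'\<in>couplings \<mu> \<nu>. integral\<^sup>L \<gamma> c \<le> integral\<^sup>L \<gamma>' c"
proof -
  let ?I = "(\<lambda>\<gamma>. integral\<^sup>L \<gamma> c) ` couplings \<mu> \<nu>"
  have cm: "c \<in> borel_measurable borel" using c by (rule borel_measurable_continuous_onI)
  have ne: "?I \<noteq> {}" using pair_measure_in_couplings[OF \<mu> \<nu>] by auto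
  have bd: "bdd_below ?I"
  proof (rule bdd_belowI2)
    fix \<gamma> assume "\<gamma> \<in> couplings \<mu> \<nu>"
    then have g: "borel_prob \<gamma>" by (rule couplings_borel_prob)
    interpret prob_space \<gamma> using g by (rule borel_prob_space)
    have "c \<in> borel_measurable \<gamma>"
      using cm by (simp add: measurable_cong_sets[OF borel_prob_sets[OF g] refl])
    then have "integrable \<gamma> c" using cB by (intro integrable_const_bound[where B = B]) auto
    moreover have "- B \<le> c z" for z using cB[of z] by linarith
    ultimately show "- B \<le> integral\<^sup>L \<gamma> c" by (intro integral_ge_const AE_I2)
  qed
  have "\<exists>\<gamma>\<in>couplings \<mu> \<nu>. integral\<^sup>L \<gamma> c < Inf ?I + 1 / real (Suc n)" for n
    using cInf_lessD[OF ne, of "Inf ?I + 1 / real (Suc n)"] by auto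
  then obtain \<gamma> where \<gamma>: "\<And>n. \<gamma> n \<in> couplings \<mu> \<nu>"
    and \<gamma>I: "\<And>n. integral\<^sup>L (\<gamma> n) c < Inf ?I + 1 / real (Suc n)"
    by metis
  interpret \<mu>: prob_space \<mu> using \<mu> by (rule borel_prob_space)
  interpret \<nu>: prob_space \<nu> using \<nu> by (rule borel_prob_space)
  interpret \<gamma>: prob_space "\<gamma> n" for n
    using couplings_borel_prob[OF \<gamma>] by (rule borel_prob_space)
  have spU: "space \<mu> = UNIV" "space \<nu> = UNIV" and spg: "space (\<gamma> n) = UNIV" for n
    using borel_prob_UNIV[OF \<mu>] borel_prob_UNIV[OF \<nu>]
      borel_prob_UNIV[OF couplings_borel_prob[OF \<gamma>]] by simp_all
  \<comment> \<open>Each marginal may lose half of the allowance \<open>1 / real (Suc j)\<close>, so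
    the product of the two compact sets loses at most all of it under any coupling.\<close>
  have "\<exists>K. compact K \<and> 1 - 1 / real (Suc j) / 2 < measure \<mu> K" for j
    by (rule borel_prob_inner_compact[OF \<mu>, of UNIV "1 / real (Suc j) / 2"])
       (use \<mu>.prob_space spU in auto)
  then obtain K where K: "\<And>j. compact (K j)" "\<And>j. 1 - 1 / real (Suc j) / 2 < measure \<mu> (K j)"
    by metis
  have "\<exists>K. compact K \<and> 1 - 1 / real (Suc j) / 2 < measure \<nu> K" for j
    by (rule borel_prob_inner_compact[OF \<nu>, of UNIV "1 / real (Suc j) / 2"])
       (use \<nu>.prob_space spU in auto)
  then obtain L where L: "\<And>j. compact (L j)" "\<And>j. 1 - 1 / real (Suc j) / 2 < measure \<nu> (L j)"
    by metis
  have tight: "1 - 1 / real (Suc j) \<le> measure (\<gamma> n) (K j \<times> L j)" for n j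
  proof -
    have KL: "K j \<in> sets borel" "L j \<in> sets borel" by (rule borel_compact[OF K(1)], rule borel_compact[OF L(1)])
    have s: "fst -` K j \<in> sets (\<gamma> n)" "snd -` L j \<in> sets (\<gamma> n)"
      using measurable_sets_borel[OF borel_measurable_fst_snd(1) KL(1)]
        measurable_sets_borel[OF borel_measurable_fst_snd(2) KL(2)]
      by (simp_all add: borel_prob_sets[OF couplings_borel_prob[OF \<gamma>]])
    have "measure (\<gamma> n) (fst -` K j) = measure \<mu> (K j)" "measure (\<gamma> n) (snd -` L j) = measure \<nu> (L j)"
      using couplings_emeasure_fst[OF \<gamma>] couplings_emeasure_snd[OF \<gamma>] KL
      by (simp_all add: measure_def)
    moreover have "measure (\<gamma> n) (fst -` K j \<union> snd -` L j) =
      measure (\<gamma> n) (fst -` K j) + measure (\<gamma> n) (snd -` L j) - measure (\<gamma> n) (fst -` K j \<inter> snd -` L j)"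
      using s by (intro measure_Un3) (auto simp: fmeasurable_def \<gamma>.emeasure_finite less_top[symmetric])
    moreover have "measure (\<gamma> n) (fst -` K j \<union> snd -` L j) \<le> 1" by simp
    moreover have KL: "fst -` K j \<inter> snd -` L j = K j \<times> L j" by auto
    moreover define e where "e = 1 / real (Suc j)"
    moreover have "1 - e / 2 < measure \<mu> (K j)" "1 - e / 2 < measure \<nu> (L j)"
      using K(2)[of j] L(2)[of j] by (simp_all add: e_def)
    ultimately have "1 - e \<le> measure (\<gamma> n) (K j \<times> L j)"
      unfolding KL by linarith
    then show ?thesis by (simp only: e_def)
  qed
  obtain s G where s: "strict_mono (s :: nat \<Rightarrow> nat)" and G: "borel_prob G"
    and lim: "\<And>(f :: 'a \<times> 'b \<Rightarrow> real) B. continuous_on UNIV f \<Longrightarrow> (\<And>x. \<bar>f x\<bar> \<le> B) \<Longrightarrow>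
      (\<lambda>n. integral\<^sup>L (\<gamma> (s n)) f) \<longlonglongrightarrow> integral\<^sup>L G f"
    by (rule tight_sequence_weak_limit[where \<gamma> = \<gamma> and K = "\<lambda>j. K j \<times> L j"])
       (use couplings_borel_prob[OF \<gamma>] K(1) L(1) tight in \<open>auto intro: compact_Times\<close>)
  interpret G: prob_space G using G by (rule borel_prob_space)
  have mG: "fst \<in> G \<rightarrow>\<^sub>M borel" "snd \<in> G \<rightarrow>\<^sub>M borel"
    using borel_measurable_fst_snd by (simp_all add: measurable_cong_sets[OF borel_prob_sets[OF G] refl])
  have mg: "fst \<in> \<gamma> n \<rightarrow>\<^sub>M borel" "snd \<in> \<gamma> n \<rightarrow>\<^sub>M borel" for n
    using borel_measurable_fst_snd
    by (simp_all add: measurable_cong_sets[OF borel_prob_sets[OF couplings_borel_prob[OF \<gamma>]] refl])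
  have "distr G borel fst = \<mu>"
  proof (rule borel_prob_eqI_integral[OF _ \<mu>])
    show "borel_prob (distr G borel fst)"
      unfolding borel_prob_def using mG by (auto intro: G.prob_space_distr)
    fix f :: "'a \<Rightarrow> real" assume f: "continuous_on UNIV f" "\<And>x. \<bar>f x\<bar> \<le> 1"
    have fm: "f \<in> borel_measurable borel" using f(1) by (rule borel_measurable_continuous_onI)
    have "(\<integral>z. f (fst z) \<partial>\<gamma> n) = integral\<^sup>L \<mu> f" for n
    proof -
      have "integral\<^sup>L (distr (\<gamma> n) borel fst) f = (\<integral>z. f (fst z) \<partial>\<gamma> n)"
        using mg fm by (intro integral_distr) auto
      then show ?thesis using \<gamma>[of n] by (simp add: couplings_def)
    qed
    moreover have "(\<lambda>n. \<integral>z. f (fst z) \<partial>\<gamma> (s n)) \<longlonglongrightarrow> (\<integral>z. f (fst z) \<partial>G)"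
      by (rule lim[of _ 1, OF continuous_on_compose2[OF f(1) continuous_on_fst[OF continuous_on_id]]])
         (auto intro: f(2))
    ultimately have "integral\<^sup>L \<mu> f = (\<integral>z. f (fst z) \<partial>G)"
      by (simp add: LIMSEQ_const_iff)
    then show "integral\<^sup>L (distr G borel fst) f = integral\<^sup>L \<mu> f"
      using mG fm by (simp add: integral_distr)
  qed
  moreover have "distr G borel snd = \<nu>"
  proof (rule borel_prob_eqI_integral[OF _ \<nu>])
    show "borel_prob (distr G borel snd)"
      unfolding borel_prob_def using mG by (auto intro: G.prob_space_distr)
    fix f :: "'b \<Rightarrow> real" assume f: "continuous_on UNIV f" "\<And>x. \<bar>f x\<bar> \<le> 1"
    have fm: "f \<in> borel_measurable borel" using f(1) by (rule borel_measurable_continuous_onI)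
    have "(\<integral>z. f (snd z) \<partial>\<gamma> n) = integral\<^sup>L \<nu> f" for n
    proof -
      have "integral\<^sup>L (distr (\<gamma> n) borel snd) f = (\<integral>z. f (snd z) \<partial>\<gamma> n)"
        using mg fm by (intro integral_distr) auto
      then show ?thesis using \<gamma>[of n] by (simp add: couplings_def)
    qed
    moreover have "(\<lambda>n. \<integral>z. f (snd z) \<partial>\<gamma> (s n)) \<longlonglongrightarrow> (\<integral>z. f (snd z) \<partial>G)"
      by (rule lim[of _ 1, OF continuous_on_compose2[OF f(1) continuous_on_snd[OF continuous_on_id]]])
         (auto intro: f(2))
    ultimately have "integral\<^sup>L \<nu> f = (\<integral>z. f (snd z) \<partial>G)"
      by (simp add: LIMSEQ_const_iff)
    then show "integral\<^sup>L (distr G borel snd) f = integral\<^sup>L \<nu> f"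
      using mG fm by (simp add: integral_distr)
  qed
  ultimately have "G \<in> couplings \<mu> \<nu>" using G by (simp add: couplings_def)
  moreover have "integral\<^sup>L G c \<le> Inf ?I"
  proof (rule LIMSEQ_le[OF lim[OF c cB]])
    have "(\<lambda>n. 1 / real (Suc n)) \<longlonglongrightarrow> 0"
      using LIMSEQ_inverse_real_of_nat by (simp add: inverse_eq_divide)
    then have "(\<lambda>n. 1 / real (Suc (s n))) \<longlonglongrightarrow> 0"
      using s by (auto intro: LIMSEQ_subseq_LIMSEQ[unfolded o_def])
    then show "(\<lambda>n. Inf ?I + 1 / real (Suc (s n))) \<longlonglongrightarrow> Inf ?I"
      using tendsto_add[OF tendsto_const, of _ 0 sequentially "Inf ?I"] by simp
    show "\<exists>N. \<forall>n\<ge>N. integral\<^sup>L (\<gamma> (s n)) c \<le> Inf ?I + 1 / real (Suc (s n))"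
      using \<gamma>I less_imp_le by blast
  qed
  ultimately show ?thesis
    using cINF_lower[OF bd] by (meson order_trans)
qed

section \<open>Monotonicity of the support\<close>

text \<open>The competitor is the law of \<open>(x\<^sub>1, y\<^sub>2)\<close> on the symmetric event that exchanging the second
  coordinates of two independent samples pays off, and of \<open>(x\<^sub>1, y\<^sub>1)\<close> elsewhere. By symmetry it has
  the same marginals.\<close>

lemma optimal_coupling_swap_null:
  fixes c :: "'a::second_countable_topology \<times> 'b::second_countable_topology \<Rightarrow> real"
  assumes \<gamma>: "\<gamma> \<in> couplings \<mu> \<nu>" and \<mu>: "borel_prob \<mu>" and \<nu>: "borel_prob \<nu>"
    and opt: "\<And>\<gamma>'. \<gamma>' \<in> couplings \<mu> \<nu> \<Longrightarrow> integral\<^sup>L \<gamma> c \<le> integral\<^sup>L \<gamma>' c"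
    and c: "continuous_on UNIV c" and cB: "\<And>z. \<bar>c z\<bar> \<le> B"
  shows "emeasure (\<gamma> \<Otimes>\<^sub>M \<gamma>) {(z, w). c (fst z, snd w) + c (fst w, snd z) < c z + c w} = 0"
    and "open {(z, w). c (fst z, snd w) + c (fst w, snd z) < c z + c w}"
proof -
  define P where "P = \<gamma> \<Otimes>\<^sub>M \<gamma>"
  have g: "borel_prob \<gamma>" using \<gamma> by (rule couplings_borel_prob)
  interpret \<gamma>: prob_space \<gamma> using g by (rule borel_prob_space)
  interpret PP: pair_prob_space \<gamma> \<gamma> ..
  interpret P: prob_space P unfolding P_def by (rule PP.prob_space_axioms)
  note sg = borel_prob_sets[OF g]
  have sP[measurable_cong]: "sets P = sets borel"
    unfolding P_def using sets_pair_measure_cong[OF sg sg] unfolding borel_prod .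
  have spP: "space P = UNIV"
    unfolding P_def space_pair_measure using borel_prob_UNIV[OF g] by simp
  define sw :: "('a \<times> 'b) \<times> 'a \<times> 'b \<Rightarrow> ('a \<times> 'b) \<times> 'a \<times> 'b" where "sw = (\<lambda>(z, w). (w, z))"
  define gain where "gain u = c (fst u) + c (snd u)
    - (c (fst (fst u), snd (snd u)) + c (fst (snd u), snd (fst u)))" for u
  define Q where "Q = {u. 0 < gain u}"
  have Qeq: "{(z, w). c (fst z, snd w) + c (fst w, snd z) < c z + c w} = Q"
    unfolding Q_def gain_def by auto
  have cont: "continuous_on UNIV (\<lambda>u. c (fst u))" "continuous_on UNIV (\<lambda>u. c (snd u))"
    "continuous_on UNIV (\<lambda>u. c (fst (fst u), snd (snd u)))"
    "continuous_on UNIV (\<lambda>u. c (fst (snd u), snd (fst u)))"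
    by (rule continuous_on_compose2[OF c];
        intro continuous_on_Pair continuous_on_fst continuous_on_snd continuous_on_id subset_UNIV)+
  have mc[measurable]: "(\<lambda>u. c (fst u)) \<in> borel_measurable borel" "(\<lambda>u. c (snd u)) \<in> borel_measurable borel"
    "(\<lambda>u. c (fst (fst u), snd (snd u))) \<in> borel_measurable borel"
    "(\<lambda>u. c (fst (snd u), snd (fst u))) \<in> borel_measurable borel"
    using cont by (auto intro: borel_measurable_continuous_onI)
  have gainc: "continuous_on UNIV gain"
    unfolding gain_def by (intro continuous_on_diff continuous_on_add cont)
  have oQ: "open Q"
    unfolding Q_def using open_Collect_less[OF continuous_on_const gainc] by simp
  then show "open {(z, w). c (fst z, snd w) + c (fst w, snd z) < c z + c w}"
    unfolding Qeq .
  have Q[measurable]: "Q \<in> sets borel" using oQ by simp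
  have gain_sw: "gain (sw u) = gain u" for u
    unfolding gain_def sw_def by (simp add: case_prod_beta)
  have Qsw: "sw u \<in> Q \<longleftrightarrow> u \<in> Q" for u
    unfolding Q_def by (simp add: gain_sw)
  have swm: "sw \<in> P \<rightarrow>\<^sub>M P"
    unfolding P_def sw_def by (rule measurable_pair_swap')
  have Psw: "distr P P sw = P"
    unfolding P_def sw_def using PP.distr_pair_swap by simp
  have emsw: "emeasure P (sw -` E) = emeasure P E" if "E \<in> sets borel" for E
    using emeasure_distr[OF swm, of E] that unfolding Psw by (simp add: sP spP)
  have intsw: "(\<integral>u. f (sw u) \<partial>P) = integral\<^sup>L P f" if "f \<in> borel_measurable borel"
    for f :: "_ \<Rightarrow> real"
    using integral_distr[OF swm, of f] that unfolding Psw by (simp add: measurable_cong_sets[OF sP refl])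
  \<comment> \<open>\<open>T\<close> keeps the first coordinate, so only the second marginal needs
    the symmetry of \<open>Q\<close>.\<close>
  define T where "T u = (if u \<in> Q then (fst (fst u), snd (snd u)) else fst u)" for u
  have fsT: "fst (T u) = fst (fst u)" "snd (T u) = (if u \<in> Q then snd (snd u) else snd (fst u))" for u
    by (simp_all add: T_def)
  have Tm: "T \<in> P \<rightarrow>\<^sub>M borel"
  proof -
    have "(\<lambda>u. (fst (fst u), snd (snd u))) \<in> (borel :: (('a \<times> 'b) \<times> 'a \<times> 'b) measure) \<rightarrow>\<^sub>M borel"
      by (intro borel_measurable_continuous_onI continuous_on_Pair continuous_on_fst
          continuous_on_snd continuous_on_id)
    moreover have "fst \<in> (borel :: (('a \<times> 'b) \<times> 'a \<times> 'b) measure) \<rightarrow>\<^sub>M borel"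
      by (rule borel_measurable_fst_snd)
    ultimately have "T \<in> borel \<rightarrow>\<^sub>M borel"
      unfolding T_def using Q by (intro measurable_If_set) auto
    then show ?thesis by (simp add: measurable_cong_sets[OF sP refl])
  qed
  define \<gamma>' where "\<gamma>' = distr P borel T"
  have em1: "emeasure P (fst -` E) = emeasure \<gamma> E" if "E \<in> sets borel" for E
  proof -
    have "fst -` E = E \<times> space \<gamma>" using borel_prob_UNIV[OF g] by auto
    then show ?thesis
      unfolding P_def using \<gamma>.emeasure_pair_measure_Times[of E \<gamma> "space \<gamma>"] that
      by (simp add: sg \<gamma>.emeasure_space_1 sets.top[of \<gamma>, unfolded sg])
  qed
  have vb: "f -` E \<in> sets borel" if "continuous_on UNIV f" "E \<in> sets borel"
    for f :: "(('a \<times> 'b) \<times> 'a \<times> 'b) \<Rightarrow> 'z::topological_space" and E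
    using borel_measurable_continuous_onI[OF that(1)] that(2) by (rule measurable_sets_borel)
  have "\<gamma>' \<in> couplings \<mu> \<nu>"
  proof (rule couplingsI[OF _ \<mu> \<nu>])
    show "borel_prob \<gamma>'"
      unfolding borel_prob_def \<gamma>'_def using P.prob_space_distr[OF Tm] by simp
    show "emeasure \<gamma>' (fst -` A) = emeasure \<mu> A" if A: "A \<in> sets borel" for A
    proof -
      have "T -` (fst -` A) = fst -` (fst -` A)" by (simp add: vimage_def fsT)
      then show ?thesis
        unfolding \<gamma>'_def using emeasure_distr[OF Tm, of "fst -` A"] em1[of "fst -` A"]
          measurable_sets_borel[OF borel_measurable_fst_snd(1) A] couplings_emeasure_fst[OF \<gamma> A]
        by (simp add: spP)
    qed
    show "emeasure \<gamma>' (snd -` B) = emeasure \<nu> B" if B: "B \<in> sets borel" for B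
    proof -
      let ?E1 = "Q \<inter> (\<lambda>u. snd (fst u)) -` B" and ?E2 = "Q \<inter> (\<lambda>u. snd (snd u)) -` B"
        and ?E3 = "(- Q) \<inter> (\<lambda>u. snd (fst u)) -` B"
      have s: "?E1 \<in> sets borel" "?E2 \<in> sets borel" "?E3 \<in> sets borel"
        by (intro sets.Int vb B Q borel_comp continuous_on_fst continuous_on_snd continuous_on_id)+
      have "T -` (snd -` B) = ?E2 \<union> ?E3"
        by (intro set_eqI) (simp add: fsT)
      then have "emeasure \<gamma>' (snd -` B) = emeasure P (?E2 \<union> ?E3)"
        unfolding \<gamma>'_def using emeasure_distr[OF Tm, of "snd -` B"]
          measurable_sets_borel[OF borel_measurable_fst_snd(2) B] by (simp add: spP)
      also have "\<dots> = emeasure P ?E2 + emeasure P ?E3"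
        using s by (intro plus_emeasure[symmetric]) (auto simp: sP)
      also have "sw -` ?E1 = ?E2"
        by (intro set_eqI) (simp add: Qsw, simp add: sw_def case_prod_beta)
      then have "emeasure P ?E2 = emeasure P ?E1" using emsw[OF s(1)] by simp
      also have "emeasure P ?E1 + emeasure P ?E3 = emeasure P (?E1 \<union> ?E3)"
        using s by (intro plus_emeasure) (auto simp: sP)
      also have "?E1 \<union> ?E3 = fst -` (snd -` B)" by auto
      also have "emeasure P \<dots> = emeasure \<nu> B"
        using em1[of "snd -` B"] measurable_sets_borel[OF borel_measurable_fst_snd(2) B]
          couplings_emeasure_snd[OF \<gamma> B] by simp
      finally show ?thesis .
    qed
  qed
  then have le: "integral\<^sup>L \<gamma> c \<le> integral\<^sup>L \<gamma>' c" by (rule opt)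
  have cm: "c \<in> borel_measurable borel" using c by (rule borel_measurable_continuous_onI)
  have i\<gamma>': "integral\<^sup>L \<gamma>' c = (\<integral>u. c (T u) \<partial>P)"
    unfolding \<gamma>'_def using Tm cm by (rule integral_distr)
  have i\<gamma>: "integral\<^sup>L \<gamma> c = (\<integral>u. c (fst u) \<partial>P)"
  proof -
    have mf: "fst \<in> P \<rightarrow>\<^sub>M borel"
      using borel_measurable_fst_snd(1) by (simp add: measurable_cong_sets[OF sP refl])
    have "distr P borel fst = \<gamma>"
      by (rule measure_eqI) (simp_all add: sg emeasure_distr[OF mf] spP em1)
    then show ?thesis using integral_distr[OF mf cm] by simp
  qed
  \<comment> \<open>\<open>d\<close> is the saving due to \<open>T\<close>. It has no sign by
    itself, but \<open>d u\<close> and \<open>d (sw u)\<close> have the same integral and add up to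
    the gain on \<open>Q\<close>, which is positive there. Optimality thus forces \<open>Q\<close>
    to be null.\<close>
  define d where "d u = indicator Q u * (c (fst u) - c (fst (fst u), snd (snd u)))" for u
  have dm[measurable]: "d \<in> borel_measurable borel"
    unfolding d_def by measurable
  have dB: "\<bar>d u\<bar> \<le> 2 * B" for u
  proof -
    have "0 \<le> B" using cB[of undefined] by linarith
    then show ?thesis
      unfolding d_def using cB[of "fst u"] cB[of "(fst (fst u), snd (snd u))"]
      by (auto split: split_indicator)
  qed
  have di: "integrable P d" "integrable P (\<lambda>u. d (sw u))"
  proof -
    show "integrable P d"
      using dB by (intro P.integrable_const_bound[where B = "2 * B"]) auto
    have "(\<lambda>u. d (sw u)) \<in> borel_measurable P"
      using swm dm by (auto intro: measurable_compose simp: measurable_cong_sets[OF sP refl])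
    then show "integrable P (\<lambda>u. d (sw u))"
      using dB by (intro P.integrable_const_bound[where B = "2 * B"]) auto
  qed
  have ci: "integrable P (\<lambda>u. c (fst u))"
    using cB by (intro P.integrable_const_bound[where B = B]) auto
  have "c (T u) = c (fst u) - d u" for u
    unfolding T_def d_def by (simp split: split_indicator)
  then have "integral\<^sup>L \<gamma>' c = integral\<^sup>L \<gamma> c - integral\<^sup>L P d"
    unfolding i\<gamma>' i\<gamma> using ci di by simp
  then have "integral\<^sup>L P d \<le> 0" using le by simp
  moreover have "(\<integral>u. d (sw u) \<partial>P) = integral\<^sup>L P d"
    by (rule intsw[OF dm])
  moreover have dg: "d u + d (sw u) = indicator Q u * gain u" for u
  proof -
    have "indicator Q (sw u) = (indicator Q u :: real)" using Qsw[of u] by (simp add: indicator_def)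
    then show ?thesis
      unfolding d_def gain_def by (simp add: sw_def case_prod_beta algebra_simps)
  qed
  ultimately have "(\<integral>u. indicator Q u * gain u \<partial>P) \<le> 0"
    using Bochner_Integration.integral_add[OF di] by simp
  moreover have Qg: "0 \<le> indicator Q u * gain u" for u
    by (auto simp: Q_def split: split_indicator)
  ultimately have "(\<integral>u. indicator Q u * gain u \<partial>P) = 0"
    by (simp add: integral_nonneg_AE antisym)
  moreover have "integrable P (\<lambda>u. indicator Q u * gain u)"
    using Bochner_Integration.integrable_add[OF di] unfolding dg .
  ultimately have "AE u in P. indicator Q u * gain u = 0"
    using integral_nonneg_eq_0_iff_AE[of P "\<lambda>u. indicator Q u * gain u"] Qg by simp
  then have "AE u in P. u \<notin> Q"
    by eventually_elim (auto simp: Q_def split: split_indicator_asm)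
  then have "emeasure P Q = 0"
    using AE_iff_measurable[of Q P "\<lambda>u. u \<notin> Q"] Q sP spP by simp
  then show "emeasure (\<gamma> \<Otimes>\<^sub>M \<gamma>) {(z, w). c (fst z, snd w) + c (fst w, snd z) < c z + c w} = 0"
    unfolding Qeq P_def .
qed

text \<open>By second countability the union of all null open sets is a countable subunion, hence
  null; the support is its complement.\<close>

lemma topological_support:
  fixes M :: "'a::second_countable_topology measure"
  assumes "sets M = sets borel"
  shows "\<exists>S. closed S \<and> emeasure M (- S) = 0 \<and> (\<forall>z\<in>S. \<forall>U. open U \<longrightarrow> z \<in> U \<longrightarrow> 0 < emeasure M U)"
proof -
  let ?F = "{U. open U \<and> emeasure M U = 0}"
  obtain F where F: "F \<subseteq> ?F" "countable F" "\<Union>F = \<Union>?F"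
    using Lindelof[of ?F] by auto
  show ?thesis
  proof (intro exI[of _ "- \<Union>?F"] conjI ballI allI impI)
    show "closed (- \<Union>?F)" by (intro closed_Compl open_Union) auto
    have "(\<Union>U\<in>F. U) \<in> null_sets M"
      using F by (intro null_sets_UN') (auto simp: null_sets_def assms)
    then show "emeasure M (- (- \<Union>?F)) = 0"
      using F(3) by (simp add: null_sets_def)
    show "0 < emeasure M U" if "z \<in> - \<Union>?F" "open U" "z \<in> U" for z U
    proof (rule ccontr)
      assume "\<not> 0 < emeasure M U"
      then have "U \<in> ?F" using that by (simp add: zero_less_iff_neq_zero)
      then show False using that by blast
    qed
  qed
qed

text \<open>The two-point case of cyclical monotonicity with respect to \<open>c\<close>.\<close>

definition pairwise_monotone :: "('a \<times> 'b \<Rightarrow> real) \<Rightarrow> ('a \<times> 'b) set \<Rightarrow> bool" where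
  "pairwise_monotone c S \<longleftrightarrow> (\<forall>x y x' y'. (x, y) \<in> S \<longrightarrow> (x', y') \<in> S \<longrightarrow>
    c (x, y) + c (x', y') \<le> c (x, y') + c (x', y))"

text \<open>The set \<open>Q\<close> of profitable exchanges is open and null for the product
  measure. A violation at two support points would put an open rectangle into \<open>Q\<close>, with
  both sides of positive mass. Passing to the support thus turns an almost-everywhere statement on
  pairs into a pointwise one.\<close>

lemma optimal_coupling_support_monotone:
  fixes c :: "'a::second_countable_topology \<times> 'b::second_countable_topology \<Rightarrow> real"
  assumes \<gamma>: "\<gamma> \<in> couplings \<mu> \<nu>" and \<mu>: "borel_prob \<mu>" and \<nu>: "borel_prob \<nu>"
    and opt: "\<And>\<gamma>'. \<gamma>' \<in> couplings \<mu> \<nu> \<Longrightarrow> integral\<^sup>L \<gamma> c \<le> integral\<^sup>L \<gamma>' c"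
    and c: "continuous_on UNIV c" and cB: "\<And>z. \<bar>c z\<bar> \<le> B"
  obtains S where "closed S" "emeasure \<gamma> (- S) = 0" "pairwise_monotone c S"
proof -
  have g: "borel_prob \<gamma>" using \<gamma> by (rule couplings_borel_prob)
  interpret \<gamma>: prob_space \<gamma> using g by (rule borel_prob_space)
  note sg = borel_prob_sets[OF g]
  obtain S where S: "closed S" "emeasure \<gamma> (- S) = 0"
    "\<forall>z\<in>S. \<forall>U. open U \<longrightarrow> z \<in> U \<longrightarrow> 0 < emeasure \<gamma> U"
    using topological_support[OF sg] by (elim exE conjE)
  define Q where "Q = {(z, w). c (fst z, snd w) + c (fst w, snd z) < c z + c w}"
  have Q0: "emeasure (\<gamma> \<Otimes>\<^sub>M \<gamma>) Q = 0" and oQ: "open Q"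
    unfolding Q_def using optimal_coupling_swap_null[OF \<gamma> \<mu> \<nu> opt c cB] by simp_all
  have "c (x, y) + c (x', y') \<le> c (x, y') + c (x', y)" if "(x, y) \<in> S" "(x', y') \<in> S" for x y x' y'
  proof (rule ccontr)
    assume "\<not> ?thesis"
    then have "((x, y), (x', y')) \<in> Q" by (simp add: Q_def)
    then obtain U V where UV: "open U" "open V" "((x, y), (x', y')) \<in> U \<times> V" "U \<times> V \<subseteq> Q"
      by (rule open_prod_elim[OF oQ])
    have "Q \<in> sets (\<gamma> \<Otimes>\<^sub>M \<gamma>)"
      using sets_pair_measure_cong[OF sg sg] oQ unfolding borel_prod by simp
    then have "emeasure (\<gamma> \<Otimes>\<^sub>M \<gamma>) (U \<times> V) \<le> emeasure (\<gamma> \<Otimes>\<^sub>M \<gamma>) Q"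
      by (rule emeasure_mono[OF UV(4)])
    moreover have "emeasure (\<gamma> \<Otimes>\<^sub>M \<gamma>) (U \<times> V) = emeasure \<gamma> U * emeasure \<gamma> V"
      using UV sg by (intro \<gamma>.emeasure_pair_measure_Times) auto
    ultimately have "emeasure \<gamma> U * emeasure \<gamma> V = 0" using Q0 by simp
    then show False using S(3)[rule_format, OF that(1) UV(1)]
        S(3)[rule_format, OF that(2) UV(2)] UV(3) by (auto simp: zero_less_iff_neq_zero)
  qed
  then have "pairwise_monotone c S" unfolding pairwise_monotone_def by blast
  then show thesis by (rule that[OF S(1,2)])
qed

text \<open>Null sets of the midpoint are null for both couplings, so whatever carries the midpoint
  carries both of them.\<close>

lemma couplings_midpoint:
  fixes c :: "'a::topological_space \<times> 'b::topological_space \<Rightarrow> real"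
  assumes \<gamma>: "\<gamma> \<in> couplings \<mu> \<nu>" and \<gamma>': "\<gamma>' \<in> couplings \<mu> \<nu>"
    and \<mu>: "borel_prob \<mu>" and \<nu>: "borel_prob \<nu>"
    and c: "c \<in> borel_measurable borel" and cB: "\<And>z. \<bar>c z\<bar> \<le> B"
  obtains \<rho> where "\<rho> \<in> couplings \<mu> \<nu>"
    "\<And>A. A \<in> sets borel \<Longrightarrow> emeasure \<rho> A = 0 \<Longrightarrow> emeasure \<gamma> A = 0 \<and> emeasure \<gamma>' A = 0"
    "integral\<^sup>L \<rho> c = (integral\<^sup>L \<gamma> c + integral\<^sup>L \<gamma>' c) / 2"
proof -
  note g = couplings_borel_prob[OF \<gamma>] couplings_borel_prob[OF \<gamma>']
  interpret \<gamma>: prob_space \<gamma> using g(1) by (rule borel_prob_space)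
  interpret \<gamma>': prob_space \<gamma>' using g(2) by (rule borel_prob_space)
  let ?b = "measure_pmf (bernoulli_pmf (1/2))"
  define N where "N b = (if b then \<gamma> else \<gamma>')" for b
  \<comment> \<open>A fair coin chooses between the two couplings.\<close>
  define \<rho> where "\<rho> = ?b \<bind> N"
  have N: "N \<in> ?b \<rightarrow>\<^sub>M subprob_algebra borel"
    using g by (auto simp: N_def space_subprob_algebra borel_prob_sets \<gamma>.subprob_space_axioms
        \<gamma>'.subprob_space_axioms)
  have half: "ennreal (1/2) * a + ennreal (1/2) * a = a" for a
    by (metis distrib_right ennreal_plus field_sum_of_halves mult_1 ennreal_1 zero_le_divide_1_iff zero_le_numeral)
  have em: "emeasure \<rho> A = emeasure \<gamma> A * ennreal (1/2) + emeasure \<gamma>' A * ennreal (1/2)"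
    if "A \<in> sets borel" for A
    unfolding \<rho>_def using emeasure_bind[OF _ N that] by (simp add: N_def)
  have "prob_space \<rho>"
    unfolding \<rho>_def
    by (rule measure_pmf.prob_space_bind[OF _ N])
       (auto simp: N_def \<gamma>.prob_space_axioms \<gamma>'.prob_space_axioms)
  moreover have "sets \<rho> = sets borel"
    unfolding \<rho>_def using N by (subst sets_bind[where N = borel]) (auto simp: N_def g borel_prob_sets)
  ultimately have \<rho>: "borel_prob \<rho>" by (simp add: borel_prob_def)
  interpret \<rho>: prob_space \<rho> using \<rho> by (rule borel_prob_space)
  have "\<rho> \<in> couplings \<mu> \<nu>"
  proof (rule couplingsI[OF \<rho> \<mu> \<nu>])
    show "emeasure \<rho> (fst -` A) = emeasure \<mu> A" if A: "A \<in> sets borel" for A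
      using em[OF measurable_sets_borel[OF borel_measurable_fst_snd(1) A]] half
      by (simp add: couplings_emeasure_fst[OF \<gamma> A] couplings_emeasure_fst[OF \<gamma>' A] mult.commute)
    show "emeasure \<rho> (snd -` A) = emeasure \<nu> A" if A: "A \<in> sets borel" for A
      using em[OF measurable_sets_borel[OF borel_measurable_fst_snd(2) A]] half
      by (simp add: couplings_emeasure_snd[OF \<gamma> A] couplings_emeasure_snd[OF \<gamma>' A] mult.commute)
  qed
  moreover have "emeasure \<gamma> A = 0 \<and> emeasure \<gamma>' A = 0" if "A \<in> sets borel" "emeasure \<rho> A = 0" for A
    using em[OF that(1)] that(2) by simp
  moreover have "integral\<^sup>L \<rho> c = (integral\<^sup>L \<gamma> c + integral\<^sup>L \<gamma>' c) / 2"
  proof -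
    \<comment> \<open>The cost of the mixture is computed as a nonnegative integral; adding
      \<open>B\<close> makes the integrand nonnegative.\<close>
    have nn: "integrable M (\<lambda>z. c z + B)" "(\<integral>\<^sup>+z. ennreal (c z + B) \<partial>M) = ennreal (integral\<^sup>L M c + B)"
      "0 \<le> integral\<^sup>L M c + B"
      if M: "borel_prob M" for M
    proof -
      interpret M: prob_space M using M by (rule borel_prob_space)
      have "c \<in> borel_measurable M"
        using c by (simp add: measurable_cong_sets[OF borel_prob_sets[OF M] refl])
      then have i: "integrable M c" using cB by (intro M.integrable_const_bound[where B = B]) auto
      then show i': "integrable M (\<lambda>z. c z + B)" by simp
      have ge: "0 \<le> c z + B" for z using cB[of z] by linarith
      have e: "integral\<^sup>L M (\<lambda>z. c z + B) = integral\<^sup>L M c + B" using i by (simp add: M.prob_space)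
      show "(\<integral>\<^sup>+z. ennreal (c z + B) \<partial>M) = ennreal (integral\<^sup>L M c + B)"
        unfolding e[symmetric] using i' ge by (intro nn_integral_eq_integral) auto
      show "0 \<le> integral\<^sup>L M c + B"
        unfolding e[symmetric] using ge by (intro integral_nonneg_AE) auto
    qed
    have "(\<integral>\<^sup>+z. ennreal (c z + B) \<partial>\<rho>) =
      (\<integral>\<^sup>+z. ennreal (c z + B) \<partial>\<gamma>) * ennreal (1/2) + (\<integral>\<^sup>+z. ennreal (c z + B) \<partial>\<gamma>') * ennreal (1/2)"
      unfolding \<rho>_def using c by (subst nn_integral_bind[OF _ N]) (auto simp: N_def)
    then have "ennreal (integral\<^sup>L \<rho> c + B) = ennreal (integral\<^sup>L \<gamma> c + B) * ennreal (1/2)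
      + ennreal (integral\<^sup>L \<gamma>' c + B) * ennreal (1/2)"
      unfolding nn(2)[OF \<rho>] nn(2)[OF g(1)] nn(2)[OF g(2)] .
    also have "\<dots> = ennreal ((integral\<^sup>L \<gamma> c + B) * (1/2)) + ennreal ((integral\<^sup>L \<gamma>' c + B) * (1/2))"
      by (simp only: ennreal_mult[OF nn(3)[OF g(1)]] ennreal_mult[OF nn(3)[OF g(2)]] zero_le_divide_1_iff
          zero_le_numeral)
    also have "\<dots> = ennreal ((integral\<^sup>L \<gamma> c + B) * (1/2) + (integral\<^sup>L \<gamma>' c + B) * (1/2))"
      using nn(3)[OF g(1)] nn(3)[OF g(2)] by (intro ennreal_plus[symmetric]) auto
    finally have "ennreal (integral\<^sup>L \<rho> c + B) =
      ennreal ((integral\<^sup>L \<gamma> c + B) * (1/2) + (integral\<^sup>L \<gamma>' c + B) * (1/2))" .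
    then have "integral\<^sup>L \<rho> c + B = (integral\<^sup>L \<gamma> c + B) * (1/2) + (integral\<^sup>L \<gamma>' c + B) * (1/2)"
      using nn(3)[OF \<rho>] nn(3)[OF g(1)] nn(3)[OF g(2)] by (subst (asm) ennreal_inj) auto
    then show ?thesis by (simp add: field_simps)
  qed
  ultimately show thesis using that by blast
qed

section \<open>Uniqueness and limb structure\<close>

text \<open>Where \<open>p\<close> is injective, a closed set \<open>F\<close> coincides up to null
  sets with the preimage of its image, and the mass of that preimage is given by the image measure
  under \<open>p\<close>. Compactness of the \<open>K i\<close> makes the image Borel.\<close>

lemma measure_eqI_injective_projection:
  fixes \<rho> \<rho>' :: "'z::t2_space measure" and p :: "'z \<Rightarrow> 'w::t2_space"
    and K :: "'i::countable \<Rightarrow> 'z set"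
  assumes sets: "sets \<rho> = sets borel" "sets \<rho>' = sets borel"
    and fin: "finite_measure \<rho>" and p: "continuous_on UNIV p"
    and K: "\<And>i. compact (K i)" and B: "B \<in> sets borel"
    and inj: "inj_on p ((\<Union>i. K i) \<inter> p -` B)"
    and null: "emeasure \<rho> (- ((\<Union>i. K i) \<inter> p -` B)) = 0" "emeasure \<rho>' (- ((\<Union>i. K i) \<inter> p -` B)) = 0"
    and marg: "\<And>C. C \<in> sets borel \<Longrightarrow> emeasure \<rho> (p -` C) = emeasure \<rho>' (p -` C)"
  shows "\<rho> = \<rho>'"
proof -
  let ?T = "(\<Union>i. K i) \<inter> p -` B"
  have pm: "p -` C \<in> sets borel" if "C \<in> sets borel" for C
    using borel_measurable_continuous_onI[OF p] that by (rule measurable_sets_borel)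
  have KU: "(\<Union>i. K i) \<in> sets borel"
    by (intro sets.countable_UN') (auto intro: borel_compact K)
  have T: "?T \<in> sets borel" using KU pm[OF B] by blast
  have em: "emeasure \<rho> F = emeasure \<rho>' F" if F: "closed F" for F
  proof -
    \<comment> \<open>A point of \<open>p -\<close> \<open>B\<close> with the same image as some
      \<open>w\<close> in \<open>K i\<close> forces \<open>w\<close> into the region where
      \<open>p\<close> is injective; without \<open>B\<close> this would fail.\<close>
    define P where "P = B \<inter> (\<Union>i. p ` (F \<inter> K i))"
    have "compact (p ` (F \<inter> K i))" for i
      using compact_Int_closed[OF K F] continuous_on_subset[OF p subset_UNIV]
      by (intro compact_continuous_image) (auto simp: Int_commute)
    then have "(\<Union>i. p ` (F \<inter> K i)) \<in> sets borel"
      by (intro sets.countable_UN') (auto intro: borel_compact)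
    then have P: "P \<in> sets borel" unfolding P_def using B by blast
    have iff: "z \<in> F \<longleftrightarrow> z \<in> p -` P" if z: "z \<in> ?T" for z
    proof
      assume "z \<in> F"
      then show "z \<in> p -` P" using z unfolding P_def by blast
    next
      assume "z \<in> p -` P"
      then obtain w i where w: "w \<in> F" "w \<in> K i" "p w = p z" and "p z \<in> B"
        unfolding P_def by auto
      then have "w \<in> ?T" by auto
      then have "w = z" using inj_onD[OF inj w(3)] z by blast
      then show "z \<in> F" using w by simp
    qed
    have ae: "emeasure M F = emeasure M (p -` P)" if s: "sets M = sets borel" and n: "emeasure M (- ?T) = 0" for M
    proof (rule emeasure_eq_AE)
      have "- ?T \<in> sets M" unfolding s by (rule borel_comp[OF T])
      with n have "- ?T \<in> null_sets M" by (rule null_setsI)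
      then show "AE z in M. z \<in> F \<longleftrightarrow> z \<in> p -` P"
        by (rule AE_I') (use iff in blast)
      show "F \<in> sets M" "p -` P \<in> sets M"
        unfolding s using borel_closed[OF F] pm[OF P] by simp_all
    qed
    show ?thesis
      unfolding ae[OF sets(1) null(1)] ae[OF sets(2) null(2)] by (rule marg[OF P])
  qed
  show ?thesis
  proof (rule measure_eqI_generator_eq[where E = "Collect closed" and \<Omega> = UNIV and A = "\<lambda>_. UNIV"])
    have "sets (borel :: 'z measure) = sigma_sets UNIV (Collect closed)"
      unfolding borel_eq_closed by (intro sets_measure_of) simp
    then show "sets \<rho> = sigma_sets UNIV (Collect closed)" "sets \<rho>' = sigma_sets UNIV (Collect closed)"
      using sets by simp_all
    show "emeasure \<rho> UNIV \<noteq> \<infinity>"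
      using finite_measure.emeasure_finite[OF fin] by simp
  qed (use em in \<open>auto simp: Int_stable_def\<close>)
qed

text \<open>In the bipartite graph with edge set \<open>T\<close>, no walk \<open>x'\<close>,
  \<open>y1\<close>, \<open>x\<close>, \<open>y2\<close>, \<open>x''\<close> has
  \<open>y1 \<noteq> y2\<close> and both ends different from \<open>x\<close>.\<close>

definition limb_property :: "('a \<times> 'b) set \<Rightarrow> bool" where
  "limb_property T \<longleftrightarrow> (\<forall>x y1 y2. (x, y1) \<in> T \<longrightarrow> (x, y2) \<in> T \<longrightarrow> y1 \<noteq> y2 \<longrightarrow>
    (\<forall>x'. (x', y1) \<in> T \<longrightarrow> x' = x) \<or> (\<forall>x'. (x', y2) \<in> T \<longrightarrow> x' = x))"

definition shared :: "('a \<times> 'b) set \<Rightarrow> 'b set" where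
  "shared T = {y. \<exists>x x'. x \<noteq> x' \<and> (x, y) \<in> T \<and> (x', y) \<in> T}"

lemma limb_property_shared_unique:
  assumes "limb_property T" "(x, y1) \<in> T" "(x, y2) \<in> T" "y1 \<in> shared T" "y2 \<in> shared T"
  shows "y1 = y2"
  using assms unfolding limb_property_def shared_def by blast

text \<open>All of X is the single piece I_1; Y splits into I_0, the shared points, and I_2, the
  others. The graph limb f_1 maps part of I_1 into I_0, the antigraph limb f_2 maps part of I_2 into
  I_1, as the inclusions of domains and ranges demand. In the encoding these are
  \<open>IX 0\<close>, \<open>IY 0\<close>, \<open>IY 1\<close>, \<open>h 0\<close> and
  \<open>g 1\<close>.\<close>

lemma limb_property_imp_numbered_limb_system:
  assumes "limb_property T"
  shows "numbered_limb_system_le 2 T"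
proof -
  define IX :: "nat \<Rightarrow> 'a set" where "IX i = (if i = 0 then UNIV else {})" for i
  define IY where "IY i = (if i = 0 then shared T else if i = 1 then - shared T else {})" for i :: nat
  define DX where "DX i = (if i = 0 then {x. \<exists>y\<in>shared T. (x, y) \<in> T} else {})" for i :: nat
  define h where "h i x = (SOME y. y \<in> shared T \<and> (x, y) \<in> T)" for i :: nat and x
  define DY where "DY i = (if i = 1 then {y. y \<notin> shared T \<and> (\<exists>x. (x, y) \<in> T)} else {})" for i :: nat
  define g where "g i y = (SOME x. (x, y) \<in> T)" for i :: nat and y
  have h: "h i x \<in> shared T \<and> (x, h i x) \<in> T" if "x \<in> DX 0" for i x
    using that unfolding h_def DX_def by (auto intro: someI2)
  have heq: "h i x = y" if "y \<in> shared T" "(x, y) \<in> T" for i x y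
    using h[of x i] that limb_property_shared_unique[OF assms] by (auto simp: DX_def)
  have g: "(g i y, y) \<in> T" if "y \<in> DY 1" for i y
    using that unfolding g_def DY_def by (auto intro: someI)
  have geq: "g i y = x" if "y \<notin> shared T" "(x, y) \<in> T" for i x y
    using g[of y i] that unfolding DY_def shared_def by auto
  have "T = Graph (DX 0) (h 0) \<union> Antigraph (DY 1) (g 1)"
  proof (rule set_eqI)
    fix z :: "'a \<times> 'b"
    obtain x y where z: "z = (x, y)" by force
    show "z \<in> T \<longleftrightarrow> z \<in> Graph (DX 0) (h 0) \<union> Antigraph (DY 1) (g 1)"
    proof (cases "y \<in> shared T")
      case True
      have "(x, y) \<in> T \<longleftrightarrow> x \<in> DX 0 \<and> y = h 0 x"
        using True h[of x 0] heq[of y x 0] by (auto simp: DX_def)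
      then show ?thesis unfolding z Graph_def Antigraph_def using True by (auto simp: DY_def)
    next
      case False
      have "(x, y) \<in> T \<longleftrightarrow> y \<in> DY 1 \<and> x = g 1 y"
        using False g[of y 1] geq[of y x 1] by (auto simp: DY_def)
      then show ?thesis unfolding z Graph_def Antigraph_def using False h[of x 0] by auto
    qed
  qed
  moreover have "(\<Union>i. Graph (DX i) (h i)) = Graph (DX 0) (h 0)"
    by (auto simp: DX_def Graph_def split: if_splits)
  moreover have "(\<Union>i\<in>{1..}. Antigraph (DY i) (g i)) = Antigraph (DY 1) (g 1)"
    by (auto simp: DY_def Antigraph_def split: if_splits)
  moreover have "(\<Union>i. IX i) = UNIV" "disjoint_family IX"
    by (auto simp: IX_def disjoint_family_on_def)
  moreover have "(\<Union>i. IY i) = UNIV"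
    by (auto simp: IY_def split: if_splits)
  moreover have "disjoint_family IY"
    by (auto simp: IY_def disjoint_family_on_def)
  moreover have "DY i \<union> h i ` DX i \<subseteq> IY i" for i
    using h by (cases "i = 0") (auto simp: DY_def IY_def DX_def)
  moreover have "DX i \<union> g (Suc i) ` DY (Suc i) \<subseteq> IX i" for i
    by (auto simp: DX_def DY_def IX_def)
  moreover have "2 * i > 2 \<Longrightarrow> DY i = {}" "2 * i + 1 > 2 \<Longrightarrow> DX i = {}" for i
    by (auto simp: DX_def DY_def)
  ultimately show ?thesis
    unfolding numbered_limb_system_le_def
    by (intro exI[of _ IX] exI[of _ IY] exI[of _ DX] exI[of _ h] exI[of _ DY] exI[of _ g]) simp
qed

text \<open>Distinctness of two partners is an open condition; written as distance at least
  \<open>1 / real (Suc k)\<close> for some \<open>k\<close>, it becomes a countable union of closed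
  ones, and \<open>shared\<close> a countable union of projected compact sets. In particular it is
  Borel.\<close>

lemma shared_sigma_compact:
  fixes K :: "nat \<Rightarrow> ('a::metric_space \<times> 'b::metric_space) set"
  assumes K: "\<And>n. compact (K n)"
  shows "\<exists>C :: nat \<times> nat \<times> nat \<Rightarrow> 'b set. (\<forall>i. compact (C i)) \<and> shared (\<Union>n. K n) = (\<Union>i. C i)"
proof -
  define R where "R k = {(z :: 'a \<times> 'b, w :: 'a \<times> 'b). snd z = snd w \<and> 1 / real (Suc k) \<le> dist (fst z) (fst w)}" for k
  define C where "C = (\<lambda>(m, n, k). (\<lambda>u. snd (fst u)) ` ((K m \<times> K n) \<inter> R k))"
  have R: "closed (R k)" for k
  proof -
    have "R k = {u. snd (fst u) = snd (snd u)} \<inter> {u. 1 / real (Suc k) \<le> dist (fst (fst u)) (fst (snd u))}"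
      unfolding R_def by auto
    moreover have "closed {u :: ('a \<times> 'b) \<times> 'a \<times> 'b. snd (fst u) = snd (snd u)}"
      by (intro closed_Collect_eq continuous_on_fst continuous_on_snd continuous_on_id)
    moreover have "closed {u :: ('a \<times> 'b) \<times> 'a \<times> 'b. 1 / real (Suc k) \<le> dist (fst (fst u)) (fst (snd u))}"
      by (intro closed_Collect_le continuous_on_const continuous_on_dist continuous_on_fst
          continuous_on_snd continuous_on_id)
    ultimately show ?thesis by (simp add: closed_Int)
  qed
  have "compact (C i)" for i
  proof -
    obtain m n k where i: "i = (m, n, k)" by (cases i)
    have "compact ((K m \<times> K n) \<inter> R k)"
      by (rule compact_Int_closed[OF compact_Times[OF K K] R])
    then have "compact ((\<lambda>u. snd (fst u)) ` ((K m \<times> K n) \<inter> R k))"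
      by (rule compact_continuous_image[rotated])
         (intro continuous_on_fst continuous_on_snd continuous_on_id)
    then show ?thesis by (simp add: C_def i)
  qed
  moreover have "shared (\<Union>n. K n) = (\<Union>i. C i)"
  proof (rule set_eqI)
    fix y
    show "y \<in> shared (\<Union>n. K n) \<longleftrightarrow> y \<in> (\<Union>i. C i)"
    proof
      assume "y \<in> shared (\<Union>n. K n)"
      then obtain x x' m n where x: "x \<noteq> x'" "(x, y) \<in> K m" "(x', y) \<in> K n"
        unfolding shared_def by blast
      have "0 < dist x x'" using x(1) by simp
      then obtain k where "inverse (real (Suc k)) < dist x x'"
        using reals_Archimedean by blast
      then have "((x, y), (x', y)) \<in> (K m \<times> K n) \<inter> R k"
        using x unfolding R_def by (simp add: inverse_eq_divide)
      then have "y \<in> C (m, n, k)" unfolding C_def prod.case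
        by (rule image_eqI[rotated]) simp
      then show "y \<in> (\<Union>i. C i)" by blast
    next
      assume "y \<in> (\<Union>i. C i)"
      then obtain m n k where "y \<in> C (m, n, k)" by auto
      then obtain z w where zw: "z \<in> K m" "w \<in> K n" "(z, w) \<in> R k" "y = snd z"
        unfolding C_def by auto
      then have R': "snd w = y" "1 / real (Suc k) \<le> dist (fst z) (fst w)"
        unfolding R_def by simp_all
      moreover have "0 < 1 / real (Suc k)" by simp
      ultimately have "0 < dist (fst z) (fst w)" by linarith
      then have "fst z \<noteq> fst w" by simp
      moreover have "z = (fst z, y)" "w = (fst w, y)" using zw(4) R'(1) by (simp_all add: prod_eq_iff)
      then have "(fst z, y) \<in> K m" "(fst w, y) \<in> K n" using zw(1,2) by simp_all
      ultimately have "fst z \<noteq> fst w \<and> (fst z, y) \<in> (\<Union>n. K n) \<and> (fst w, y) \<in> (\<Union>n. K n)" by blast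
      then show "y \<in> shared (\<Union>n. K n)" unfolding shared_def by blast
    qed
  qed
  ultimately show ?thesis by (intro exI[of _ C]) simp
qed

theorem couplings_unique_on_limb_property:
  fixes K :: "nat \<Rightarrow> ('a::metric_space \<times> 'b::metric_space) set"
  assumes \<gamma>: "\<gamma> \<in> couplings \<mu> \<nu>" and \<gamma>': "\<gamma>' \<in> couplings \<mu> \<nu>"
    and K: "\<And>n. compact (K n)" and limb: "limb_property (\<Union>n. K n)"
    and null: "emeasure \<gamma> (- (\<Union>n. K n)) = 0" "emeasure \<gamma>' (- (\<Union>n. K n)) = 0"
  shows "\<gamma> = \<gamma>'"
proof -
  define T where "T = (\<Union>n. K n)"
  have T: "T \<in> sets borel"
    unfolding T_def by (intro sets.countable_UN') (auto intro: borel_compact K)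
  obtain C :: "nat \<times> nat \<times> nat \<Rightarrow> 'b set"
    where C0: "(\<forall>i. compact (C i)) \<and> shared T = (\<Union>i. C i)"
    using shared_sigma_compact[of K, OF K] unfolding T_def[symmetric] ..
  have C: "compact (C i)" "shared T = (\<Union>i. C i)" for i
    using spec[OF conjunct1[OF C0]] conjunct2[OF C0] by this
  have M: "shared T \<in> sets borel"
    unfolding C(2) by (intro sets.countable_UN') (auto intro: borel_compact C)
  have vf: "fst -` A \<in> sets borel" if "A \<in> sets borel" for A :: "'a set"
    using measurable_sets_borel[OF borel_measurable_fst_snd(1) that] .
  have vs: "snd -` A \<in> sets borel" if "A \<in> sets borel" for A :: "'b set"
    using measurable_sets_borel[OF borel_measurable_fst_snd(2) that] .
  define V where "V = (snd -` shared T :: ('a \<times> 'b) set)"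
  have V: "V \<in> sets borel" "- V \<in> sets borel" unfolding V_def using vs[OF M] borel_comp by auto
  have fin: "finite_measure M" if "M \<in> couplings \<mu> \<nu>" for M
    using borel_prob_space[OF couplings_borel_prob[OF that]] by (simp add: prob_space_def)
  note s = borel_prob_sets[OF couplings_borel_prob]
  have restr: "emeasure (density M (indicator W)) A = emeasure M (W \<inter> A)"
    if "M \<in> couplings \<mu> \<nu>" "W \<in> sets borel" "A \<in> sets borel" for M W A
    using that s[OF that(1)] by (intro emeasure_restricted) auto
  have nullr: "emeasure M (W \<inter> - (T \<inter> W)) = 0"
    if "M \<in> couplings \<mu> \<nu>" "emeasure M (- T) = 0" for M W
  proof -
    have "- T \<in> null_sets M" using that T s[OF that(1)] by (auto simp: null_sets_def)
    then have "emeasure M (W \<inter> - (T \<inter> W)) \<le> emeasure M (- T)"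
      by (intro emeasure_mono) (auto simp: null_sets_def)
    then show ?thesis using that by simp
  qed
  have nulld: "emeasure (density M (indicator W)) (- (T \<inter> W)) = 0"
    if "M \<in> couplings \<mu> \<nu>" "emeasure M (- T) = 0" "W \<in> sets borel" for M W
  proof -
    have "- (T \<inter> W) \<in> sets borel" using T that(3) by (intro borel_comp sets.Int)
    then show ?thesis using restr[OF that(1,3)] nullr[OF that(1,2)] by simp
  qed
  \<comment> \<open>The complement of \<open>shared T\<close> need not be a countable union of
    compact sets, but it constrains only the coordinate projected to, so it enters through
    \<open>B\<close> and not through \<open>K\<close>.\<close>
  have "density \<gamma> (indicator (- V)) = density \<gamma>' (indicator (- V))"
  proof (rule measure_eqI_injective_projection[where p = snd and K = K and B = "- shared T"])
    have TV: "(\<Union>i. K i) \<inter> snd -` (- shared T) = T \<inter> - V" unfolding T_def V_def by auto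
    show "inj_on snd ((\<Union>i. K i) \<inter> snd -` (- shared T))"
      unfolding TV
    proof (rule inj_onI)
      fix u v assume uv: "u \<in> T \<inter> - V" "v \<in> T \<inter> - V" "snd u = snd v"
      obtain x y x' where xy: "u = (x, y)" "v = (x', y)"
        using uv(3) by (metis prod.collapse)
      then have "(x, y) \<in> T" "(x', y) \<in> T" "y \<notin> shared T"
        using uv(1,2) by (simp_all add: V_def)
      then have "x = x'" unfolding shared_def by blast
      then show "u = v" by (simp add: xy)
    qed
    show "emeasure (density \<gamma> (indicator (- V))) (- ((\<Union>i. K i) \<inter> snd -` (- shared T))) = 0"
      "emeasure (density \<gamma>' (indicator (- V))) (- ((\<Union>i. K i) \<inter> snd -` (- shared T))) = 0"
      unfolding TV by (rule nulld[OF \<gamma> null(1)[folded T_def] V(2)],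
          rule nulld[OF \<gamma>' null(2)[folded T_def] V(2)])
    show "emeasure (density \<gamma> (indicator (- V))) (snd -` A) = emeasure (density \<gamma>' (indicator (- V))) (snd -` A)"
      if A: "A \<in> sets borel" for A
    proof -
      have eq: "- V \<inter> snd -` A = snd -` (- shared T \<inter> A)" unfolding V_def by blast
      have m: "- shared T \<inter> A \<in> sets borel" using A borel_comp[OF M] by blast
      show ?thesis
        unfolding restr[OF \<gamma> V(2) vs[OF A]] restr[OF \<gamma>' V(2) vs[OF A]] eq
          couplings_emeasure_snd[OF \<gamma> m] couplings_emeasure_snd[OF \<gamma>' m] ..
    qed
    show "finite_measure (density \<gamma> (indicator (- V)))"
      using fin[OF \<gamma>] V(2) s[OF \<gamma>] by (intro finite_measure.finite_measure_restricted) auto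
  qed (use K M s[OF \<gamma>] s[OF \<gamma>'] in \<open>auto intro: continuous_on_snd continuous_on_id\<close>)
  then have out: "emeasure \<gamma> (- V \<inter> A) = emeasure \<gamma>' (- V \<inter> A)" if "A \<in> sets borel" for A
    using restr[OF \<gamma> V(2) that] restr[OF \<gamma>' V(2) that] by (simp only:)
  have split: "emeasure M A = emeasure M (V \<inter> A) + emeasure M (- V \<inter> A)"
    if "M \<in> couplings \<mu> \<nu>" "A \<in> sets borel" for M A
  proof -
    have "V \<inter> A \<in> sets M" "- V \<inter> A \<in> sets M" using V that s[OF that(1)] by auto
    then have "emeasure M (V \<inter> A) + emeasure M (- V \<inter> A) = emeasure M (V \<inter> A \<union> - V \<inter> A)"
      by (rule plus_emeasure) blast
    also have "V \<inter> A \<union> - V \<inter> A = A" by blast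
    finally show ?thesis by (rule sym)
  qed
  \<comment> \<open>Now the constraint is on the second coordinate while the projection is to the
    first. It is therefore built into the compact sets, using that \<open>shared T\<close> is the
    union of the \<open>C i\<close>.\<close>
  have "density \<gamma> (indicator V) = density \<gamma>' (indicator V)"
  proof (rule measure_eqI_injective_projection[where p = fst and B = UNIV
        and K = "\<lambda>(n, i). K n \<inter> snd -` C i"])
    have TV: "(\<Union>j. case j of (n, i) \<Rightarrow> K n \<inter> snd -` C i) \<inter> fst -` UNIV = T \<inter> V"
      unfolding T_def V_def C(2)[unfolded T_def] by auto
    show "inj_on fst ((\<Union>j. case j of (n, i) \<Rightarrow> K n \<inter> snd -` C i) \<inter> fst -` UNIV)"
      unfolding TV using limb_property_shared_unique[OF limb] unfolding T_def[symmetric]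
      by (intro inj_onI prod_eqI) (auto simp: V_def)
    show "emeasure (density \<gamma> (indicator V))
        (- ((\<Union>j. case j of (n, i) \<Rightarrow> K n \<inter> snd -` C i) \<inter> fst -` UNIV)) = 0"
      "emeasure (density \<gamma>' (indicator V))
        (- ((\<Union>j. case j of (n, i) \<Rightarrow> K n \<inter> snd -` C i) \<inter> fst -` UNIV)) = 0"
      unfolding TV by (rule nulld[OF \<gamma> null(1)[folded T_def] V(1)],
          rule nulld[OF \<gamma>' null(2)[folded T_def] V(1)])
    show "emeasure (density \<gamma> (indicator V)) (fst -` A) = emeasure (density \<gamma>' (indicator V)) (fst -` A)"
      if A: "A \<in> sets borel" for A
    proof -
      have "emeasure \<gamma> (V \<inter> fst -` A) + emeasure \<gamma> (- V \<inter> fst -` A) = emeasure \<gamma> (fst -` A)"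
        by (rule split[OF \<gamma> vf[OF A], symmetric])
      also have "\<dots> = emeasure \<gamma>' (fst -` A)"
        by (simp only: couplings_emeasure_fst[OF \<gamma> A] couplings_emeasure_fst[OF \<gamma>' A])
      also have "\<dots> = emeasure \<gamma>' (V \<inter> fst -` A) + emeasure \<gamma>' (- V \<inter> fst -` A)"
        by (rule split[OF \<gamma>' vf[OF A]])
      also have "\<dots> = emeasure \<gamma>' (V \<inter> fst -` A) + emeasure \<gamma> (- V \<inter> fst -` A)"
        by (simp only: out[OF vf[OF A]])
      finally have "emeasure \<gamma> (- V \<inter> fst -` A) + emeasure \<gamma> (V \<inter> fst -` A) =
        emeasure \<gamma> (- V \<inter> fst -` A) + emeasure \<gamma>' (V \<inter> fst -` A)"
        by (simp only: add.commute)
      \<comment> \<open>Cancelling a common summand in \<open>ennreal\<close> requires it to be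
        finite.\<close>
      moreover have "emeasure \<gamma> (- V \<inter> fst -` A) \<noteq> \<infinity>"
        using finite_measure.emeasure_finite[OF fin[OF \<gamma>]] by simp
      ultimately have "emeasure \<gamma> (V \<inter> fst -` A) = emeasure \<gamma>' (V \<inter> fst -` A)"
        by (simp add: ennreal_add_left_cancel)
      then show ?thesis
        unfolding restr[OF \<gamma> V(1) vf[OF A]] restr[OF \<gamma>' V(1) vf[OF A]] .
    qed
    show "finite_measure (density \<gamma> (indicator V))"
      using fin[OF \<gamma>] V(1) s[OF \<gamma>] by (intro finite_measure.finite_measure_restricted) auto
    have "closed (snd -` C i :: ('a \<times> 'b) set)" for i
      using compact_imp_closed[OF C(1)] by (intro closed_vimage continuous_on_snd continuous_on_id)
    then show "compact (case j of (n, i) \<Rightarrow> K n \<inter> snd -` C i)" for j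
      using K by (auto split: prod.split intro: compact_Int_closed)
  qed (use s[OF \<gamma>] s[OF \<gamma>'] in \<open>auto intro: continuous_on_fst continuous_on_id\<close>)
  then have inn: "emeasure \<gamma> (V \<inter> A) = emeasure \<gamma>' (V \<inter> A)" if "A \<in> sets borel" for A
    using restr[OF \<gamma> V(1) that] restr[OF \<gamma>' V(1) that] by (simp only:)
  show ?thesis
  proof (rule measure_eqI)
    show "sets \<gamma> = sets \<gamma>'" using s[OF \<gamma>] s[OF \<gamma>'] by simp
    fix A assume "A \<in> sets \<gamma>"
    then have A: "A \<in> sets borel" using s[OF \<gamma>] by simp
    show "emeasure \<gamma> A = emeasure \<gamma>' A"
      unfolding split[OF \<gamma> A] split[OF \<gamma>' A] by (simp only: inn[OF A] out[OF A])
  qed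
qed

section \<open>Points with two slopes\<close>

text \<open>Locally, the orthogonal projection along \<open>w\<close> is injective on
  \<open>T\<close> with Lipschitz inverse, so \<open>T\<close> is locally a Lipschitz image of a
  subset of a hyperplane.\<close>

lemma negligible_cone_condition:
  fixes T :: "'m::euclidean_space set"
  assumes w: "norm w = 1" and \<delta>: "0 < \<delta>"
    and cone: "\<And>x y. x \<in> T \<Longrightarrow> y \<in> T \<Longrightarrow> norm (x - y) < \<delta> \<Longrightarrow> \<bar>w \<bullet> (x - y)\<bar> \<le> norm (x - y) / 2"
  shows "negligible T"
proof (subst locally_negligible_alt, rule ballI)
  fix a assume a: "a \<in> T"
  define U where "U = T \<inter> ball a (\<delta> / 2)"
  define p where "p x = x - (w \<bullet> x) *\<^sub>R w" for x
  have ww: "w \<bullet> w = 1" using w by (simp add: norm_eq_1)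
  \<comment> \<open>By Pythagoras the projection keeps at least three quarters of the squared norm,
    so any constant from 2 / sqrt 3 on would do; 2 avoids the root. The radius
    \<open>\<delta> / 2\<close> brings any two points of \<open>U\<close> within
    \<open>\<delta>\<close> of each other.\<close>
  have lip: "norm (x - y) \<le> 2 * norm (p x - p y)" if "x \<in> U" "y \<in> U" for x y
  proof -
    define h where "h = x - y"
    have "dist x a < \<delta> / 2" "dist y a < \<delta> / 2"
      using that unfolding U_def by (simp_all add: dist_commute)
    then have "dist x y < \<delta>" by (rule dist_triangle_half_l)
    then have "\<bar>w \<bullet> h\<bar> \<le> norm h / 2"
      using cone[of x y] that unfolding U_def h_def by (simp add: dist_norm)
    then have "\<bar>w \<bullet> h\<bar> \<le> \<bar>norm h / 2\<bar>" by simp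
    then have "(w \<bullet> h)\<^sup>2 \<le> (norm h / 2)\<^sup>2" by (rule abs_le_square_iff[THEN iffD1])
    moreover have ph: "p x - p y = h - (w \<bullet> h) *\<^sub>R w"
      unfolding p_def h_def by (simp add: algebra_simps)
    moreover have "(norm (h - (w \<bullet> h) *\<^sub>R w))\<^sup>2 = (norm h)\<^sup>2 - (w \<bullet> h)\<^sup>2"
      unfolding power2_norm_eq_inner
      by (simp add: inner_diff_left inner_diff_right ww inner_commute power2_eq_square)
    ultimately have "4 * (w \<bullet> h)\<^sup>2 \<le> (norm h)\<^sup>2"
      and e: "(2 * norm (p x - p y))\<^sup>2 = 4 * ((norm h)\<^sup>2 - (w \<bullet> h)\<^sup>2)"
      by (simp_all add: power_divide power_mult_distrib)
    moreover have "N \<le> 4 * (N - W)" if "4 * W \<le> N" "0 \<le> N" for N W :: real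
      using that by argo
    ultimately have "(norm h)\<^sup>2 \<le> (2 * norm (p x - p y))\<^sup>2"
      unfolding e using zero_le_power2 by blast
    then show ?thesis
      unfolding h_def by (rule power2_le_imp_le) simp
  qed
  have inj: "inj_on p U"
  proof (rule inj_onI)
    fix x y assume "x \<in> U" "y \<in> U" "p x = p y"
    then show "x = y" using lip[of x y] by simp
  qed
  have "negligible (p ` U)"
  proof (rule negligible_subset)
    show "negligible {x. w \<bullet> x = 0}" using w by (intro negligible_hyperplane) auto
    show "p ` U \<subseteq> {x. w \<bullet> x = 0}" by (auto simp: p_def inner_diff_right ww)
  qed
  then have "negligible (inv_into U p ` (p ` U))"
  proof (rule negligible_locally_Lipschitz_image[OF order_refl])
    fix x assume x: "x \<in> p ` U"
    show "\<exists>T B. open T \<and> x \<in> T \<and>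
      (\<forall>y\<in>p ` U \<inter> T. norm (inv_into U p y - inv_into U p x) \<le> B * norm (y - x))"
    proof (intro exI[of _ UNIV] exI[of _ 2] conjI ballI)
      fix y assume "y \<in> p ` U \<inter> UNIV"
      then show "norm (inv_into U p y - inv_into U p x) \<le> 2 * norm (y - x)"
        using lip[OF inv_into_into[of y p U] inv_into_into[OF x]] x
        by (simp add: f_inv_into_f)
    qed auto
  qed
  then have "negligible U" by (simp only: inv_into_image_cancel[OF inj order_refl])
  then show "\<exists>U. openin (top_of_set T) U \<and> a \<in> U \<and> negligible U"
    using a \<delta> unfolding U_def by (intro exI[of _ "T \<inter> ball a (\<delta> / 2)"]) (auto intro: openin_open_Int)
qed

text \<open>Two partners of \<open>p\<close> with different slopes \<open>a\<close>, \<open>b\<close> play the role of two supergradients of a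
  potential at \<open>p\<close>; pairwise monotonicity between nearby points of this kind already forces the cone
  condition across \<open>a - b\<close>, so neither a potential nor Rademacher's theorem is needed.\<close>

lemma negligible_two_slopes:
  fixes F :: "'m::euclidean_space \<Rightarrow> 'b \<Rightarrow> real" and R :: "'m \<Rightarrow> 'b \<Rightarrow> bool"
  assumes mono: "\<And>p q y z. R p y \<Longrightarrow> R q z \<Longrightarrow> F p y + F q z \<le> F p z + F q y"
  shows "negligible {p. \<exists>y z a b. R p y \<and> R p z \<and> a \<noteq> b \<and>
    ((\<lambda>q. F q y) has_derivative (\<lambda>h. a \<bullet> h)) (at p) \<and> ((\<lambda>q. F q z) has_derivative (\<lambda>h. b \<bullet> h)) (at p)}"
    (is "negligible ?E")
proof -
  obtain D :: "'m set" where D: "countable D" "\<And>X. open X \<Longrightarrow> X \<noteq> {} \<Longrightarrow> \<exists>d\<in>D. d \<in> X"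
    using countable_dense_exists by blast
  \<comment> \<open>A first-order expansion with slope \<open>a\<close> at \<open>p\<close>, with a
    fixed scale and a fixed relative error in place of a limit. This lets uncountably many points
    share one pair of slopes from the countable set \<open>D\<close>.\<close>
  define near where "near a e n p y \<longleftrightarrow>
    (\<forall>q. norm (q - p) < 1 / real (Suc n) \<longrightarrow> \<bar>F q y - F p y - a \<bullet> (q - p)\<bar> \<le> e * norm (q - p))"
    for a e n p y
  \<comment> \<open>The quarter is chosen for the cone: two expansion errors, one at each point, add
    up to \<open>norm (a - b) / 2\<close>, which becomes the cone constant one half once
    \<open>a - b\<close> is normalized.\<close>
  define E where "E = (\<lambda>(a, b, n). {p. \<exists>y z. R p y \<and> R p z \<and>
    near a (norm (a - b) / 4) n p y \<and> near b (norm (a - b) / 4) n p z})"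
  \<comment> \<open>Replacing \<open>a\<close> by \<open>a0\<close> costs
    \<open>norm (a - a0)\<close> of the error \<open>e\<close>, and differentiability supplies the
    rest. The claim for all \<open>m \<ge> n\<close> allows two expansions to share a scale.\<close>
  have nearI: "\<exists>n. \<forall>m\<ge>n. near a0 e m p y"
    if der: "((\<lambda>q. F q y) has_derivative (\<lambda>h. a \<bullet> h)) (at p)" and a0: "norm (a - a0) < e" for a a0 e p y
  proof -
    have "0 < e - norm (a - a0)" using a0 by simp
    then obtain d where d: "0 < d" "\<And>q. norm (q - p) < d \<Longrightarrow>
        norm (F q y - F p y - a \<bullet> (q - p)) \<le> (e - norm (a - a0)) * norm (q - p)"
      using der unfolding has_derivative_at_alt by blast
    obtain n where n: "1 / real (Suc n) < d"
      using reals_Archimedean[OF d(1)] by (auto simp: inverse_eq_divide)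
    have "near a0 e m p y" if "m \<ge> n" for m
      unfolding near_def
    proof (intro allI impI)
      fix q assume q: "norm (q - p) < 1 / real (Suc m)"
      have "1 / real (Suc m) \<le> 1 / real (Suc n)"
        using that by (intro divide_left_mono) auto
      then have "\<bar>F q y - F p y - a \<bullet> (q - p)\<bar> \<le> (e - norm (a - a0)) * norm (q - p)"
        using d(2)[of q] n q by simp
      moreover have "\<bar>(a - a0) \<bullet> (q - p)\<bar> \<le> norm (a - a0) * norm (q - p)"
        by (rule Cauchy_Schwarz_ineq2)
      ultimately show "\<bar>F q y - F p y - a0 \<bullet> (q - p)\<bar> \<le> e * norm (q - p)"
        by (simp add: left_diff_distrib inner_diff_left)
    qed
    then show ?thesis by blast
  qed
  have "negligible (E (a, b, n))" if ab: "a \<noteq> b" for a b n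
  proof -
    define w where "w = (a - b) /\<^sub>R norm (a - b)"
    \<comment> \<open>\<open>y\<close> comes from \<open>p\<close> with slope \<open>a\<close>,
      \<open>z\<close> from \<open>q\<close> with slope \<open>b\<close>; exchanging them bounds one
      sign. Every point of \<open>E\<close> has partners of both kinds, so the roles of
      \<open>p\<close> and \<open>q\<close> can be swapped for the other sign.\<close>
    have slope: "(b - a) \<bullet> (q - p) \<le> norm (a - b) / 2 * norm (q - p)"
      if pq: "p \<in> E (a, b, n)" "q \<in> E (a, b, n)" "norm (q - p) < 1 / real (Suc n)" for p q
    proof -
      obtain y where y: "R p y" "near a (norm (a - b) / 4) n p y"
        using pq(1) unfolding E_def by auto
      obtain z where z: "R q z" "near b (norm (a - b) / 4) n q z"
        using pq(2) unfolding E_def by auto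
      have "\<bar>F q y - F p y - a \<bullet> (q - p)\<bar> \<le> norm (a - b) / 4 * norm (q - p)"
        using y(2) pq(3) unfolding near_def by blast
      moreover have "\<bar>F p z - F q z - b \<bullet> (p - q)\<bar> \<le> norm (a - b) / 4 * norm (p - q)"
        using z(2) pq(3) unfolding near_def by (metis norm_minus_commute)
      moreover have "b \<bullet> (p - q) = - (b \<bullet> (q - p))" by (simp add: inner_diff_right)
      moreover have "norm (p - q) = norm (q - p)" by (rule norm_minus_commute)
      moreover have "F p y + F q z \<le> F p z + F q y" by (rule mono[OF y(1) z(1)])
      ultimately have "b \<bullet> (q - p) - a \<bullet> (q - p) \<le> 2 * (norm (a - b) / 4 * norm (q - p))"
        by (simp only:)
      then show ?thesis by (simp add: inner_diff_left)
    qed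
    show ?thesis
    proof (rule negligible_cone_condition[where w = w and \<delta> = "1 / real (Suc n)"])
      show "norm w = 1" using ab by (simp add: w_def)
      show "0 < 1 / real (Suc n)" by simp
      fix x y assume xy: "x \<in> E (a, b, n)" "y \<in> E (a, b, n)" "norm (x - y) < 1 / real (Suc n)"
      have "(b - a) \<bullet> (x - y) \<le> norm (a - b) / 2 * norm (x - y)"
        using slope[OF xy(2,1,3)] .
      moreover have "(b - a) \<bullet> (y - x) \<le> norm (a - b) / 2 * norm (y - x)"
        using slope[OF xy(1,2)] xy(3) by (simp add: norm_minus_commute)
      moreover have "(b - a) \<bullet> (x - y) = - ((a - b) \<bullet> (x - y))" "(b - a) \<bullet> (y - x) = (a - b) \<bullet> (x - y)"
        by (simp_all add: inner_diff_left inner_diff_right)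
      moreover have "norm (y - x) = norm (x - y)" by (rule norm_minus_commute)
      ultimately have "\<bar>(a - b) \<bullet> (x - y)\<bar> \<le> norm (a - b) / 2 * norm (x - y)"
        by (simp only:)
      moreover have "0 < norm (a - b)" using ab by simp
      moreover have "w \<bullet> (x - y) = ((a - b) \<bullet> (x - y)) / norm (a - b)"
        unfolding w_def by (simp only: inner_scaleR_left divide_inverse mult.commute)
      ultimately show "\<bar>w \<bullet> (x - y)\<bar> \<le> norm (x - y) / 2"
        by (simp add: abs_divide pos_divide_le_eq mult.commute)
    qed
  qed
  then have neg: "negligible (\<Union>i \<in> {(a, b, n). a \<in> D \<and> b \<in> D \<and> a \<noteq> b}. E i)"
  proof (intro negligible_countable_Union)
    have "{(a, b, n). a \<in> D \<and> b \<in> D \<and> a \<noteq> b} \<subseteq> D \<times> D \<times> (UNIV :: nat set)" by auto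
    then show "countable (E ` {(a, b, n). a \<in> D \<and> b \<in> D \<and> a \<noteq> b})"
      using D(1) by (intro countable_image) (auto elim: countable_subset)
  qed auto
  have "?E \<subseteq> (\<Union>i \<in> {(a, b, n). a \<in> D \<and> b \<in> D \<and> a \<noteq> b}. E i)"
  proof
    fix p assume "p \<in> ?E"
    then obtain y z a b where R: "R p y" "R p z" and ab: "a \<noteq> b"
      and der: "((\<lambda>q. F q y) has_derivative (\<lambda>h. a \<bullet> h)) (at p)"
        "((\<lambda>q. F q z) has_derivative (\<lambda>h. b \<bullet> h)) (at p)" by blast
    \<comment> \<open>Approximation within \<open>r / 8\<close> keeps \<open>norm (a0 - b0)\<close>
      above \<open>3 * r / 4\<close>, so a quarter of it exceeds \<open>r / 8\<close> and strictly
      dominates the slope error, as \<open>nearI\<close> requires.\<close>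
    define r where "r = norm (a - b)"
    have r: "0 < r" using ab by (simp add: r_def)
    obtain a0 where a0: "a0 \<in> D" "dist a a0 < r / 8"
      using D(2)[of "ball a (r / 8)"] r by auto
    obtain b0 where b0: "b0 \<in> D" "dist b b0 < r / 8"
      using D(2)[of "ball b (r / 8)"] r by auto
    have "r \<le> norm (a - a0) + norm (a0 - b0) + norm (b0 - b)"
      unfolding r_def using norm_triangle_ineq[of "a - a0" "a0 - b"] norm_triangle_ineq[of "a0 - b0" "b0 - b"]
      by simp
    then have r0: "r / 8 < norm (a0 - b0) / 4"
      using a0(2) b0(2) r by (simp add: dist_norm norm_minus_commute)
    then have "a0 \<noteq> b0" using r by auto
    obtain n1 where n1: "\<forall>m\<ge>n1. near a0 (norm (a0 - b0) / 4) m p y"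
      using nearI[OF der(1), of a0 "norm (a0 - b0) / 4"] a0(2) r0 by (auto simp: dist_norm)
    obtain n2 where n2: "\<forall>m\<ge>n2. near b0 (norm (a0 - b0) / 4) m p z"
      using nearI[OF der(2), of b0 "norm (a0 - b0) / 4"] b0(2) r0 by (auto simp: dist_norm)
    have "near a0 (norm (a0 - b0) / 4) (max n1 n2) p y" "near b0 (norm (a0 - b0) / 4) (max n1 n2) p z"
      using n1 n2 by simp_all
    then have "p \<in> E (a0, b0, max n1 n2)"
      unfolding E_def using R by blast
    then show "p \<in> (\<Union>i \<in> {(a, b, n). a \<in> D \<and> b \<in> D \<and> a \<noteq> b}. E i)"
      using a0(1) b0(1) \<open>a0 \<noteq> b0\<close> by blast
  qed
  then show ?thesis using neg negligible_subset by blast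
qed

section \<open>Manifolds and the twist condition\<close>

lemma C1_atlas_chart:
  assumes "C1_atlas A" "(U, \<phi>, \<psi>) \<in> A"
  shows "open U" "open (\<phi> ` U)" "homeomorphism U (\<phi> ` U) \<phi> \<psi>"
proof -
  have "is_chart (U, \<phi>, \<psi>)" using assms unfolding C1_atlas_def by blast
  then show "open U" "open (\<phi> ` U)" "homeomorphism U (\<phi> ` U) \<phi> \<psi>"
    by (simp_all add: is_chart_def)
qed

lemma C1_atlas_cover:
  assumes "C1_atlas A"
  obtains U \<phi> \<psi> where "(U, \<phi>, \<psi>) \<in> A" "x \<in> U"
proof -
  have "x \<in> (\<Union>(U, _, _)\<in>A. U)" using assms unfolding C1_atlas_def by simp
  then obtain C where C: "C \<in> A" "x \<in> (case C of (U, _, _) \<Rightarrow> U)" by (rule UN_E)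
  obtain U \<phi> \<psi> where "C = (U, \<phi>, \<psi>)" by (cases C)
  then show thesis using that C by simp
qed

section \<open>The cost and its derivatives in charts\<close>

lemma C1_prod_continuous_on:
  fixes c :: "'a::t2_space \<times> 'b::t2_space \<Rightarrow> real"
  assumes AX: "C1_atlas AX" and AY: "C1_atlas AY" and c: "C1_prod AX AY c"
  shows "continuous_on UNIV c"
proof -
  have "isCont c z" for z
  proof -
    obtain U \<phi> \<psi> where X: "(U, \<phi>, \<psi>) \<in> AX" "fst z \<in> U" using C1_atlas_cover[OF AX] .
    obtain V \<kappa> \<theta> where Y: "(V, \<kappa>, \<theta>) \<in> AY" "snd z \<in> V" using C1_atlas_cover[OF AY] .
    note U = C1_atlas_chart[OF AX X(1)] and V = C1_atlas_chart[OF AY Y(1)]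
    let ?f = "\<lambda>(p, q). c (\<psi> p, \<theta> q)"
    have "C1_on (\<phi> ` U \<times> \<kappa> ` V) ?f" using c X(1) Y(1) unfolding C1_prod_def by fast
    then have "continuous_on (\<phi> ` U \<times> \<kappa> ` V) ?f"
      unfolding C1_on_def by (meson continuous_at_imp_continuous_on has_derivative_continuous)
    then have "continuous_on (U \<times> V) (\<lambda>z. ?f (\<phi> (fst z), \<kappa> (snd z)))"
    proof (rule continuous_on_compose2)
      have "continuous_on (U \<times> V) (\<lambda>z. \<phi> (fst z))"
        by (rule continuous_on_compose2[OF homeomorphism_cont1[OF U(3)]])
           (auto intro: continuous_on_fst continuous_on_id)
      moreover have "continuous_on (U \<times> V) (\<lambda>z. \<kappa> (snd z))"
        by (rule continuous_on_compose2[OF homeomorphism_cont1[OF V(3)]])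
           (auto intro: continuous_on_snd continuous_on_id)
      ultimately show "continuous_on (U \<times> V) (\<lambda>z. (\<phi> (fst z), \<kappa> (snd z)))"
        by (rule continuous_on_Pair)
    qed auto
    moreover have "?f (\<phi> (fst w), \<kappa> (snd w)) = c w" if "w \<in> U \<times> V" for w
    proof -
      have "fst w \<in> U" "snd w \<in> V" using that by auto
      then show ?thesis
        by (simp add: homeomorphism_apply1[OF U(3)] homeomorphism_apply1[OF V(3)])
    qed
    ultimately have "continuous_on (U \<times> V) c" by (simp cong: continuous_on_cong)
    moreover have "z \<in> U \<times> V" using X(2) Y(2) by (simp add: mem_Times_iff)
    ultimately show ?thesis
      using continuous_on_eq_continuous_at[OF open_Times[OF U(1) V(1)]] by blast
  qed
  then show ?thesis by (simp add: continuous_on_eq_continuous_at)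
qed

text \<open>Riesz representation: slopes become vectors, which can be approximated from a countable
  dense set.\<close>

lemma has_derivative_inner_representation:
  fixes f :: "'m::euclidean_space \<Rightarrow> real"
  assumes "(f has_derivative L) F"
  shows "\<exists>a. L = (\<lambda>h. a \<bullet> h)"
proof -
  have "linear L" using assms by (rule has_derivative_linear)
  then have "L h = adjoint L 1 \<bullet> h" for h
    using adjoint_works[of L h 1] by (simp add: inner_commute)
  then show ?thesis by blast
qed

lemma C1_prod_partial_derivative:
  assumes AY: "C1_atlas AY" and c: "C1_prod AX AY c"
    and X: "(U, \<phi>, \<psi>) \<in> AX" "x \<in> U"
  obtains a where "((\<lambda>p. c (\<psi> p, y)) has_derivative (\<lambda>h. a \<bullet> h)) (at (\<phi> x))"
proof -
  obtain V \<kappa> \<theta> where Y: "(V, \<kappa>, \<theta>) \<in> AY" "y \<in> V" using C1_atlas_cover[OF AY] .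
  let ?f = "\<lambda>(p, q). c (\<psi> p, \<theta> q)"
  have "C1_on (\<phi> ` U \<times> \<kappa> ` V) ?f" using c X(1) Y(1) unfolding C1_prod_def by fast
  moreover have "(\<phi> x, \<kappa> y) \<in> \<phi> ` U \<times> \<kappa> ` V" using X(2) Y(2) by simp
  ultimately obtain L where "(?f has_derivative L) (at (\<phi> x, \<kappa> y))"
    unfolding C1_on_def by blast
  moreover have "((\<lambda>p. (p, \<kappa> y)) has_derivative (\<lambda>h. (h, 0))) (at (\<phi> x))"
    by (intro has_derivative_Pair has_derivative_ident has_derivative_const)
  ultimately have d: "((\<lambda>p. ?f (p, \<kappa> y)) has_derivative (\<lambda>h. L (h, 0))) (at (\<phi> x))"
    using has_derivative_compose[of "\<lambda>p. (p, \<kappa> y)"] by blast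
  have "\<theta> (\<kappa> y) = y" using C1_atlas_chart(3)[OF AY Y(1)] Y(2) by (rule homeomorphism_apply1)
  then have "((\<lambda>p. c (\<psi> p, y)) has_derivative (\<lambda>h. L (h, 0))) (at (\<phi> x))" using d by simp
  moreover from this obtain a where "(\<lambda>h. L (h, 0)) = (\<lambda>h. a \<bullet> h)"
    using has_derivative_inner_representation by blast
  ultimately show thesis using that by simp
qed

text \<open>Fermat's rule in a chart. It feeds the uniqueness clauses of
  \<open>crit_only_extrema\<close>, which speak of extrema known to be critical.\<close>

lemma critical_point_difference_extremum:
  assumes AX: "C1_atlas AX" and AY: "C1_atlas AY" and c: "C1_prod AX AY c"
    and ext: "(\<forall>z. c (x, y1) - c (x, y2) \<le> c (z, y1) - c (z, y2)) \<or>
      (\<forall>z. c (z, y1) - c (z, y2) \<le> c (x, y1) - c (x, y2))"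
  shows "critical_point AX (\<lambda>x. c (x, y1) - c (x, y2)) x"
proof -
  obtain U \<phi> \<psi> where X: "(U, \<phi>, \<psi>) \<in> AX" "x \<in> U" using C1_atlas_cover[OF AX] .
  have \<psi>: "\<psi> (\<phi> x) = x" using C1_atlas_chart(3)[OF AX X(1)] X(2) by (rule homeomorphism_apply1)
  obtain a where a: "((\<lambda>p. c (\<psi> p, y1)) has_derivative (\<lambda>h. a \<bullet> h)) (at (\<phi> x))"
    using C1_prod_partial_derivative[OF AY c X] .
  obtain b where b: "((\<lambda>p. c (\<psi> p, y2)) has_derivative (\<lambda>h. b \<bullet> h)) (at (\<phi> x))"
    using C1_prod_partial_derivative[OF AY c X] .
  have d: "((\<lambda>p. c (\<psi> p, y1) - c (\<psi> p, y2)) has_derivative (\<lambda>h. a \<bullet> h - b \<bullet> h)) (at (\<phi> x))"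
    by (rule has_derivative_diff[OF a b])
  have "(\<lambda>h. a \<bullet> h - b \<bullet> h) = (\<lambda>h. 0)"
    by (rule differential_zero_maxmin[OF UNIV_I open_UNIV d]) (use ext \<psi> in auto)
  then show ?thesis
    unfolding critical_point_def using d X by (intro bexI[OF _ X(1)]) (simp add: o_def)
qed

text \<open>\<open>negligible\<close> refers to Lebesgue measure, whereas
  \<open>abs_cont_in_charts\<close> quantifies over Borel null sets.\<close>

lemma negligible_Borel_superset:
  assumes "negligible E"
  obtains Z where "Z \<in> null_sets lborel" "E \<subseteq> Z"
  using assms by (auto simp: negligible_iff_null_sets null_sets_completion_iff2)

text \<open>In a chart, a non-critical point has two partners with different slopes, and such points
  are negligible by \<open>negligible_two_slopes\<close>. Lindelof's theorem reduces the atlas to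
  countably many charts, so one null set serves all points and all pairs of partners.\<close>

lemma monotone_set_critical_AE:
  fixes AX :: "('a::second_countable_topology set \<times> ('a \<Rightarrow> 'm::euclidean_space) \<times> ('m \<Rightarrow> 'a)) set"
    and AY :: "('b::topological_space set \<times> ('b \<Rightarrow> 'n::euclidean_space) \<times> ('n \<Rightarrow> 'b)) set"
  assumes AX: "C1_atlas AX" and AY: "C1_atlas AY" and c: "C1_prod AX AY c"
    and \<mu>: "sets \<mu> = sets borel" and ac: "abs_cont_in_charts AX \<mu>"
    and mono: "pairwise_monotone c S"
  obtains N where "N \<in> null_sets \<mu>"
    "\<forall>x y1 y2. (x, y1) \<in> S \<longrightarrow> (x, y2) \<in> S \<longrightarrow> x \<notin> N \<longrightarrow> critical_point AX (\<lambda>x. c (x, y1) - c (x, y2)) x"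
proof -
  have "\<And>U. U \<in> fst ` AX \<Longrightarrow> open U" using C1_atlas_chart(1)[OF AX] by auto
  then obtain F where F: "F \<subseteq> fst ` AX" "countable F" "\<Union>F = \<Union>(fst ` AX)"
    by (rule Lindelof)
  then obtain A where A: "A \<subseteq> AX" "countable A" "F = fst ` A"
    using countable_subset_image[of F fst AX] by blast
  define bad where "bad C x \<longleftrightarrow> x \<in> fst C \<and> (\<exists>y1 y2. (x, y1) \<in> S \<and> (x, y2) \<in> S \<and>
    \<not> critical_point AX (\<lambda>x. c (x, y1) - c (x, y2)) x)" for C :: "'a set \<times> ('a \<Rightarrow> 'm) \<times> ('m \<Rightarrow> 'a)" and x
  have "\<exists>N\<in>null_sets \<mu>. \<forall>x. bad C x \<longrightarrow> x \<in> N" if "C \<in> AX" for C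
  proof -
    obtain U \<phi> \<psi> where C: "C = (U, \<phi>, \<psi>)" by (cases C)
    then have CX: "(U, \<phi>, \<psi>) \<in> AX" using that by simp
    note U = C1_atlas_chart[OF AX CX]
    \<comment> \<open>Membership in \<open>\<phi>\<close> \<open>U\<close> is required because
      \<open>\<psi>\<close> is arbitrary outside the image of the chart.\<close>
    define R where "R p y \<longleftrightarrow> p \<in> \<phi> ` U \<and> (\<psi> p, y) \<in> S" for p y
    let ?E = "{p. \<exists>y z a b. R p y \<and> R p z \<and> a \<noteq> b \<and>
      ((\<lambda>q. c (\<psi> q, y)) has_derivative (\<lambda>h. a \<bullet> h)) (at p) \<and>
      ((\<lambda>q. c (\<psi> q, z)) has_derivative (\<lambda>h. b \<bullet> h)) (at p)}"
    have "negligible ?E"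
      by (rule negligible_two_slopes[where R = R and F = "\<lambda>p y. c (\<psi> p, y)"])
         (use mono in \<open>auto simp: R_def pairwise_monotone_def\<close>)
    then obtain Z where Z: "Z \<in> null_sets lborel" "?E \<subseteq> Z" by (rule negligible_Borel_superset)
    have "\<phi> -` Z \<inter> U \<in> sets borel"
    proof -
      have "\<phi> \<in> borel_measurable (restrict_space borel U)"
        by (rule borel_measurable_continuous_on_restrict[OF homeomorphism_cont1[OF U(3)]])
      moreover have "Z \<in> sets borel" using Z(1) by (auto simp: null_sets_def)
      ultimately have "\<phi> -` Z \<inter> space (restrict_space borel U) \<in> sets (restrict_space borel U)"
        by (rule measurable_sets)
      then show ?thesis using U(1) by (simp add: sets_restrict_space_iff space_restrict_space)
    qed
    moreover have "emeasure \<mu> (U \<inter> \<phi> -` Z) = 0"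
      using ac CX Z(1) unfolding abs_cont_in_charts_def by fast
    ultimately have "U \<inter> \<phi> -` Z \<in> null_sets \<mu>"
      by (simp add: null_sets_def \<mu> Int_commute)
    moreover have "x \<in> U \<inter> \<phi> -` Z" if bad: "bad C x" for x
    proof -
      have x: "x \<in> U" using bad by (simp add: bad_def C)
      obtain y1 y2 where y: "(x, y1) \<in> S" "(x, y2) \<in> S"
        "\<not> critical_point AX (\<lambda>x. c (x, y1) - c (x, y2)) x" using bad unfolding bad_def by blast
      have \<psi>: "\<psi> (\<phi> x) = x" using U(3) x by (rule homeomorphism_apply1)
      obtain a where a: "((\<lambda>p. c (\<psi> p, y1)) has_derivative (\<lambda>h. a \<bullet> h)) (at (\<phi> x))"
        using C1_prod_partial_derivative[OF AY c CX x] .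
      obtain b where b: "((\<lambda>p. c (\<psi> p, y2)) has_derivative (\<lambda>h. b \<bullet> h)) (at (\<phi> x))"
        using C1_prod_partial_derivative[OF AY c CX x] .
      have "a \<noteq> b"
      proof
        assume "a = b"
        then have "((\<lambda>p. c (\<psi> p, y1) - c (\<psi> p, y2)) has_derivative (\<lambda>h. 0)) (at (\<phi> x))"
          using has_derivative_diff[OF a b] by simp
        then have "critical_point AX (\<lambda>x. c (x, y1) - c (x, y2)) x"
          unfolding critical_point_def using x by (intro bexI[OF _ CX]) (simp add: o_def)
        then show False using y(3) by simp
      qed
      moreover have "R (\<phi> x) y1" "R (\<phi> x) y2" using x y(1,2) \<psi> by (simp_all add: R_def)
      ultimately have "\<phi> x \<in> ?E" using a b by blast
      then show ?thesis using Z(2) x by blast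
    qed
    ultimately show ?thesis by blast
  qed
  then obtain N where N: "\<And>C. C \<in> AX \<Longrightarrow> N C \<in> null_sets \<mu>" "\<And>C x. C \<in> AX \<Longrightarrow> bad C x \<Longrightarrow> x \<in> N C"
    by metis
  show thesis
  proof (rule that[of "\<Union>C\<in>A. N C"])
    show "(\<Union>C\<in>A. N C) \<in> null_sets \<mu>"
      using A N(1) by (intro null_sets_UN') auto
    show "\<forall>x y1 y2. (x, y1) \<in> S \<longrightarrow> (x, y2) \<in> S \<longrightarrow> x \<notin> (\<Union>C\<in>A. N C) \<longrightarrow>
      critical_point AX (\<lambda>x. c (x, y1) - c (x, y2)) x"
    proof (intro allI impI)
      fix x y1 y2 assume xy: "(x, y1) \<in> S" "(x, y2) \<in> S" "x \<notin> (\<Union>C\<in>A. N C)"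
      obtain U \<phi> \<psi> where X: "(U, \<phi>, \<psi>) \<in> AX" "x \<in> U" using C1_atlas_cover[OF AX] .
      then have "x \<in> \<Union>(fst ` AX)" by force
      then obtain C where C: "C \<in> A" "x \<in> fst C" using A(3) F(3) by blast
      show "critical_point AX (\<lambda>x. c (x, y1) - c (x, y2)) x"
      proof (rule ccontr)
        assume "\<not> ?thesis"
        then have "bad C x" using C xy unfolding bad_def by blast
        then show False using N(2)[of C x] C A(1) xy(3) by blast
      qed
    qed
  qed
qed

text \<open>Let \<open>f\<close> be the difference of costs. If \<open>x\<close> minimizes
  \<open>f\<close> and \<open>x'\<close> is a partner of \<open>y1\<close>, then monotonicity for
  \<open>(x', y1)\<close> and \<open>(x, y2)\<close> reads \<open>f x' \<le> f x\<close>. So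
  \<open>x'\<close> is a minimum too, hence critical, and equals \<open>x\<close> by uniqueness. For
  a maximum the same works with \<open>y2\<close>.\<close>

lemma monotone_set_limb_property:
  assumes AX: "C1_atlas AX" and AY: "C1_atlas AY" and c: "C1_prod AX AY c"
    and twist: "\<And>y1 y2. y1 \<noteq> y2 \<Longrightarrow> crit_only_extrema AX (\<lambda>x. c (x, y1) - c (x, y2))"
    and mono: "pairwise_monotone c T"
    and crit: "\<And>x y1 y2. (x, y1) \<in> T \<Longrightarrow> (x, y2) \<in> T \<Longrightarrow> critical_point AX (\<lambda>x. c (x, y1) - c (x, y2)) x"
  shows "limb_property T"
  unfolding limb_property_def
proof (intro allI impI)
  fix x y1 y2 assume xy: "(x, y1) \<in> T" "(x, y2) \<in> T" and ne: "y1 \<noteq> y2"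
  let ?f = "\<lambda>x. c (x, y1) - c (x, y2)"
  note tw = twist[OF ne, unfolded crit_only_extrema_def]
  have cx: "critical_point AX ?f x" using xy by (rule crit)
  then consider "\<forall>z. ?f x \<le> ?f z" | "\<forall>z. ?f z \<le> ?f x" using tw by blast
  then show "(\<forall>x'. (x', y1) \<in> T \<longrightarrow> x' = x) \<or> (\<forall>x'. (x', y2) \<in> T \<longrightarrow> x' = x)"
  proof cases
    case 1
    have "x' = x" if "(x', y1) \<in> T" for x'
    proof -
      have le: "?f x' \<le> ?f x" using mono that xy(2) unfolding pairwise_monotone_def by fastforce
      have m: "\<forall>z. ?f x' \<le> ?f z"
      proof
        fix z show "?f x' \<le> ?f z" using le 1[rule_format, of z] by linarith
      qed
      have cx': "critical_point AX ?f x'"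
        using critical_point_difference_extremum[OF AX AY c] m by blast
      show ?thesis
        by (rule tw[THEN conjunct2, THEN conjunct1, rule_format, of x' x]) (intro conjI cx' cx m 1)
    qed
    then show ?thesis by blast
  next
    case 2
    have "x' = x" if "(x', y2) \<in> T" for x'
    proof -
      have le: "?f x \<le> ?f x'" using mono xy(1) that unfolding pairwise_monotone_def by fastforce
      have m: "\<forall>z. ?f z \<le> ?f x'"
      proof
        fix z show "?f z \<le> ?f x'" using le 2[rule_format, of z] by linarith
      qed
      have cx': "critical_point AX ?f x'"
        using critical_point_difference_extremum[OF AX AY c] m by blast
      show ?thesis
        by (rule tw[THEN conjunct2, THEN conjunct2, rule_format, of x' x]) (intro conjI cx' cx m 2)
    qed
    then show ?thesis by blast
  qed
qed

text \<open>Inner regularity with losses \<open>1 / real (Suc n)\<close>. The \<open>K n\<close>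
  need not increase: their union exceeds each of them in measure, which suffices.\<close>

lemma sigma_compact_full_measure:
  fixes M :: "'a::{complete_space, second_countable_topology} measure"
  assumes M: "borel_prob M" and A: "A \<in> sets borel" and null: "emeasure M (- A) = 0"
  obtains K :: "nat \<Rightarrow> 'a set" where "\<forall>n. compact (K n) \<and> K n \<subseteq> A" "emeasure M (- (\<Union>n. K n)) = 0"
proof -
  interpret prob_space M using M by (rule borel_prob_space)
  note s = borel_prob_sets[OF M] and sp = borel_prob_UNIV[OF M]
  have "\<exists>K. compact K \<and> K \<subseteq> A \<and> measure M A - 1 / real (Suc n) < measure M K" for n
    using borel_prob_inner_compact[OF M A, of "1 / real (Suc n)"] by (metis of_nat_0_less_iff zero_less_Suc zero_less_divide_1_iff)
  then obtain K where K: "\<And>n. compact (K n)" "\<And>n. K n \<subseteq> A" "\<And>n. measure M A - 1 / real (Suc n) < measure M (K n)"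
    by metis
  have "measure M (- A) = 0" using null by (simp add: measure_def)
  then have A1: "measure M A = 1"
    using prob_compl[of A] A s sp by (simp add: Compl_eq_Diff_UNIV)
  have Kb: "(\<Union>n. K n) \<in> sets M"
    unfolding s by (intro sets.countable_UN') (auto intro: borel_compact K)
  have lt: "1 - 1 / real (Suc n) < measure M (\<Union>n. K n)" for n
  proof -
    have "measure M (K n) \<le> measure M (\<Union>n. K n)" using Kb by (intro finite_measure_mono) auto
    then show ?thesis using K(3)[of n] A1 by linarith
  qed
  have "1 \<le> measure M (\<Union>n. K n)"
  proof (rule ccontr)
    assume "\<not> ?thesis"
    then obtain n where "inverse (real (Suc n)) < 1 - measure M (\<Union>n. K n)"
      using reals_Archimedean[of "1 - measure M (\<Union>n. K n)"] by auto
    then show False using lt[of n] by (simp add: inverse_eq_divide)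
  qed
  then have "measure M (\<Union>n. K n) = 1" using prob_le_1 by (rule antisym[rotated])
  then have "measure M (- (\<Union>n. K n)) = 0"
    using prob_compl[OF Kb] sp by (simp add: Compl_eq_Diff_UNIV)
  then have "emeasure M (- (\<Union>n. K n)) = 0" by (simp add: emeasure_eq_measure)
  then show thesis using that K(1,2) by blast
qed

theorem mainTheorem4:
  fixes AX :: "('a::polish_space set \<times> ('a \<Rightarrow> 'm::euclidean_space) \<times> ('m \<Rightarrow> 'a)) set"
    and AY :: "('b::polish_space set \<times> ('b \<Rightarrow> 'n::euclidean_space) \<times> ('n \<Rightarrow> 'b)) set"
    and \<mu> :: "'a measure" and \<nu> :: "'b measure"
    and c :: "'a \<times> 'b \<Rightarrow> real"
  assumes atlasX: "C1_atlas AX"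
    and atlasY: "C1_atlas AY"
    and mu: "borel_prob \<mu>"
    and nu: "borel_prob \<nu>"
    and c_C1: "C1_prod AX AY c"
    and c_bounded: "\<exists>B. \<forall>x y. \<bar>c (x, y)\<bar> \<le> B"
    and twist: "\<And>y1 y2. y1 \<noteq> y2 \<Longrightarrow> crit_only_extrema AX (\<lambda>x. c (x, y1) - c (x, y2))"
    and dx_bdd: "dx_locally_bounded AX c"
    and mu_ac: "abs_cont_in_charts AX \<mu>"
  shows "\<exists>\<gamma>. \<gamma> \<in> couplings \<mu> \<nu>
            \<and> (\<forall>\<gamma>'\<in>couplings \<mu> \<nu>. integral\<^sup>L \<gamma> c \<le> integral\<^sup>L \<gamma>' c)
            \<and> (\<forall>\<gamma>'\<in>couplings \<mu> \<nu>. (\<forall>\<gamma>''\<in>couplings \<mu> \<nu>. integral\<^sup>L \<gamma>' c \<le> integral\<^sup>L \<gamma>'' c) \<longrightarrow> \<gamma>' = \<gamma>)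
            \<and> (\<exists>S. numbered_limb_system_le 2 S \<and> vanishes_outside \<gamma> S)"
proof -
  obtain B where B: "\<And>z. \<bar>c z\<bar> \<le> B" using c_bounded by auto
  have cont: "continuous_on UNIV c" using atlasX atlasY c_C1 by (rule C1_prod_continuous_on)
  then have cm: "c \<in> borel_measurable borel" by (rule borel_measurable_continuous_onI)
  define opt where "opt \<gamma> \<longleftrightarrow> \<gamma> \<in> couplings \<mu> \<nu> \<and>
    (\<forall>\<gamma>'\<in>couplings \<mu> \<nu>. integral\<^sup>L \<gamma> c \<le> integral\<^sup>L \<gamma>' c)" for \<gamma>
  \<comment> \<open>Stated for two minimizers to give uniqueness; taken with both equal, it gives
    the limb system of the minimizer.\<close>
  have common: "\<exists>K :: nat \<Rightarrow> ('a \<times> 'b) set. (\<forall>n. compact (K n)) \<and> limb_property (\<Union>n. K n) \<and>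
      emeasure \<gamma> (- (\<Union>n. K n)) = 0 \<and> emeasure \<gamma>' (- (\<Union>n. K n)) = 0"
    if o: "opt \<gamma>" "opt \<gamma>'" for \<gamma> \<gamma>'
  proof -
    have g: "\<gamma> \<in> couplings \<mu> \<nu>" "\<gamma>' \<in> couplings \<mu> \<nu>" using o by (simp_all add: opt_def)
    obtain \<rho> where \<rho>: "\<rho> \<in> couplings \<mu> \<nu>"
      "\<And>A. A \<in> sets borel \<Longrightarrow> emeasure \<rho> A = 0 \<Longrightarrow> emeasure \<gamma> A = 0 \<and> emeasure \<gamma>' A = 0"
      "integral\<^sup>L \<rho> c = (integral\<^sup>L \<gamma> c + integral\<^sup>L \<gamma>' c) / 2"
      by (rule couplings_midpoint[OF g mu nu cm B]) blast
    have \<rho>opt: "integral\<^sup>L \<rho> c \<le> integral\<^sup>L \<gamma>'' c" if g'': "\<gamma>'' \<in> couplings \<mu> \<nu>" for \<gamma>''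
    proof -
      have "integral\<^sup>L \<gamma> c \<le> integral\<^sup>L \<gamma>'' c" "integral\<^sup>L \<gamma>' c \<le> integral\<^sup>L \<gamma>'' c"
        using o g'' by (simp_all add: opt_def)
      then show ?thesis unfolding \<rho>(3) by simp
    qed
    obtain S where S: "closed S" "emeasure \<rho> (- S) = 0" "pairwise_monotone c S"
      by (rule optimal_coupling_support_monotone[OF \<rho>(1) mu nu \<rho>opt cont B])
    obtain N where N: "N \<in> null_sets \<mu>"
      "\<forall>x y1 y2. (x, y1) \<in> S \<longrightarrow> (x, y2) \<in> S \<longrightarrow> x \<notin> N \<longrightarrow> critical_point AX (\<lambda>x. c (x, y1) - c (x, y2)) x"
      by (rule monotone_set_critical_AE[OF atlasX atlasY c_C1 borel_prob_sets[OF mu] mu_ac S(3)])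
    have r: "borel_prob \<rho>" using \<rho>(1) by (rule couplings_borel_prob)
    have Nb: "N \<in> sets borel" using N(1) borel_prob_sets[OF mu] by (auto simp: null_sets_def)
    \<comment> \<open>Discarding the points over \<open>N\<close> costs no mass, since the first
      marginal of \<open>\<rho>\<close> is \<open>\<mu>\<close>.\<close>
    define S' where "S' = S \<inter> - (fst -` N)"
    have fN: "fst -` N \<in> sets (borel :: ('a \<times> 'b) measure)"
      using measurable_sets_borel[OF borel_measurable_fst_snd(1) Nb] .
    have S': "S' \<in> sets borel"
      unfolding S'_def using S(1) fN by (intro sets.Int borel_comp) auto
    have "- S \<in> null_sets \<rho>" "fst -` N \<in> null_sets \<rho>"
      using S(1,2) fN couplings_emeasure_fst[OF \<rho>(1) Nb] N(1)
      by (auto simp: null_sets_def borel_prob_sets[OF r])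
    then have "- S \<union> fst -` N \<in> null_sets \<rho>" by (rule null_sets.Un)
    moreover have "- S' = - S \<union> fst -` N" unfolding S'_def by blast
    ultimately have "emeasure \<rho> (- S') = 0" by (simp add: null_sets_def)
    then obtain K :: "nat \<Rightarrow> ('a \<times> 'b) set"
      where KS: "\<forall>n. compact (K n) \<and> K n \<subseteq> S'" and K0: "emeasure \<rho> (- (\<Union>n. K n)) = 0"
      by (rule sigma_compact_full_measure[OF r S'])
    have Kc: "compact (K n)" for n using KS by simp
    have sub: "(x, y) \<in> S \<and> x \<notin> N" if "(x, y) \<in> (\<Union>n. K n)" for x y
    proof -
      obtain n where "(x, y) \<in> K n" using \<open>(x, y) \<in> (\<Union>n. K n)\<close> by blast
      then have "(x, y) \<in> S'" using KS by blast
      then show ?thesis by (simp add: S'_def)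
    qed
    have "limb_property (\<Union>n. K n)"
    proof (rule monotone_set_limb_property[OF atlasX atlasY c_C1 twist])
      show "pairwise_monotone c (\<Union>n. K n)"
        using S(3) sub unfolding pairwise_monotone_def by blast
      show "critical_point AX (\<lambda>x. c (x, y1) - c (x, y2)) x"
        if "(x, y1) \<in> (\<Union>n. K n)" "(x, y2) \<in> (\<Union>n. K n)" for x y1 y2
        using sub[OF that(1)] sub[OF that(2)] N(2) by blast
    qed
    moreover have "- (\<Union>n. K n) \<in> sets borel"
      by (intro borel_comp sets.countable_UN') (auto intro: borel_compact Kc)
    ultimately show ?thesis using \<rho>(2)[OF _ K0] Kc by blast
  qed
  obtain \<gamma> where \<gamma>: "opt \<gamma>"
    using optimal_coupling_exists[OF mu nu cont B] unfolding opt_def by blast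
  have unique: "\<gamma>' = \<gamma>" if opt': "opt \<gamma>'" for \<gamma>'
  proof -
    obtain K :: "nat \<Rightarrow> ('a \<times> 'b) set" where K: "\<And>n. compact (K n)" "limb_property (\<Union>n. K n)"
      "emeasure \<gamma>' (- (\<Union>n. K n)) = 0" "emeasure \<gamma> (- (\<Union>n. K n)) = 0"
      using common[OF opt' \<gamma>] by blast
    show ?thesis
      by (rule couplings_unique_on_limb_property[of _ \<mu> \<nu>, OF _ _ K])
         (use opt' \<gamma> in \<open>simp_all add: opt_def\<close>)
  qed
  obtain K :: "nat \<Rightarrow> ('a \<times> 'b) set" where K: "\<And>n. compact (K n)" "limb_property (\<Union>n. K n)"
    "emeasure \<gamma> (- (\<Union>n. K n)) = 0"
    using common[OF \<gamma> \<gamma>] by blast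
  have "- (\<Union>n. K n) \<in> sets \<gamma>"
    unfolding borel_prob_sets[OF couplings_borel_prob[of \<gamma> \<mu> \<nu>], OF \<gamma>[unfolded opt_def, THEN conjunct1]]
    by (intro borel_comp sets.countable_UN') (auto intro: borel_compact K(1))
  then have "vanishes_outside \<gamma> (\<Union>n. K n)"
    unfolding vanishes_outside_def using K(3) by blast
  then show ?thesis
    using \<gamma> unique limb_property_imp_numbered_limb_system[OF K(2)] unfolding opt_def by blast
qed

end
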